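(* Let $\mathcal{H}$ be a finite-dimensional Hilbert space and $\{\rho_\theta;\theta\in\Theta\subset\mathbb{R}^d\}$ a smooth parametric family of density operators on $\mathcal{H}$, and let $\theta_0\in\Theta$ with $\rho_{\theta_0}$ strictly positive. Let $(M,\hat\theta)$ be any locally unbiased estimator at $\theta_0$, let $G$ be any $d\times d$ real positive matrix, and let $P:(0,\infty)\to(0,\infty)$ be an operator monotone function with $P(1)=1$ and $\frac{d}{dx}P(x)\big|_{x=1}=\frac{1+\beta}{2}$ for some $\beta\in[-1,1]$. Then $$\operatorname{Tr} G V_{\theta_0}[M,\hat\theta]\ \ge\ \operatorname{Tr} G (J^{(M)}_{\theta_0})^{-1}\ \ge\ C^{(|\beta|)}_{\theta_0,G}\ \ge\ C^{(P)}_{\theta_0,G}.$$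
   Context: Write $\rho=\rho_{\theta_0}$ and $\partial_i\rho=\frac{\partial}{\partial\theta^i}\rho_\theta|_{\theta=\theta_0}$. An estimator is a pair $(M,\hat\theta)$ of a POVM $M=\{M_x\}_{x\in\mathcal{X}}$ on a finite set $\mathcal{X}$ and a map $\hat\theta:\mathcal{X}\to\Theta$; it is locally unbiased at $\theta_0$ if $\sum_x\hat\theta^i(x)\operatorname{Tr}\rho M_x=\theta_0^i$ and $\sum_x\hat\theta^i(x)\operatorname{Tr}(\partial_j\rho) M_x=\delta^i_j$ for all $i,j$. Its covariance matrix is $V_{\theta_0}[M,\hat\theta]_{ij}=\sum_x(\hat\theta^i(x)-\theta_0^i)(\hat\theta^j(x)-\theta_0^j)\operatorname{Tr}\rho M_x$. The classical Fisher information matrix of $M$ is $J^{(M)}_{\theta_0,ij}=\sum_x\frac{(\operatorname{Tr}\partial_i\rho M_x)(\operatorname{Tr}\partial_j\rho M_x)}{\operatorname{Tr}\rho M_x}$. For an operator monotone $P$ with $P(1)=1$, let $\mathbf{L}_\rho(X)=\rho X$, $\mathbf{R}_\rho(X)=X\rho$ on $\mathcal{B}(\mathcal{H})$, define the monotone metric $K^{(P)}_\rho(X,Y)=\operatorname{Tr}X^*[(\mathbf{R}_\rho P(\mathbf{L}_\rho\mathbf{R}_\rho^{-1}))^{-1}Y]$, and $J^{(P)}_{\theta_0}=[K^{(P)}_\rho(\partial_i\rho,\partial_j\rho)]_{ij}$. For a positive complex matrix $J$ set $C(J)=\operatorname{Tr}GJ^{-1}+\operatorname{Tr}|\sqrt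 G\,\operatorname{Im}(J^{-1})\sqrt G|$ (Im is the entrywise imaginary part, $|X|=(X^*X)^{1/2}$), and $C^{(P)}_{\theta_0,G}=C(J^{(P)}_{\theta_0})$. For $\beta\in[-1,1]$, $C^{(\beta)}_{\theta_0,G}:=C^{(P^{(\beta)})}_{\theta_0,G}$ with $P^{(\beta)}(x)=\frac{1+\beta}{2}x+\frac{1-\beta}{2}$; equivalently $J^{(P^{(\beta)})}_{\theta_0}=[\operatorname{Tr}\partial_i\rho\,L^{(\beta)}_j]_{ij}$ where $L_i^{(\beta)}$ is defined by $\partial_i\rho=\frac{1+\beta}{2}\rho L_i^{(\beta)}+\frac{1-\beta}{2}L_i^{(\beta)}\rho$. Fisher information matrices are assumed invertible. *)

theory Defs
  imports "HOL-Analysis.Analysis" "Jordan_Normal_Form.Matrix" "Jordan_Normal_Form.Gauss_Jordan_Elimination"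
begin

definition mtrace :: "'a::comm_ring_1 mat \<Rightarrow> 'a" where
  "mtrace A = (\<Sum>i<dim_row A. A $$ (i,i))"

definition adj :: "complex mat \<Rightarrow> complex mat" where
  "adj A = mat (dim_col A) (dim_row A) (\<lambda>(i,j). cnj (A $$ (j,i)))"

definition cinner :: "complex vec \<Rightarrow> complex vec \<Rightarrow> complex" where
  "cinner v w = (\<Sum>i<dim_vec v. cnj (v $ i) * w $ i)"

definition hermitian :: "complex mat \<Rightarrow> bool" where
  "hermitian A \<longleftrightarrow> A \<in> carrier_mat (dim_row A) (dim_row A) \<and> adj A = A"

definition psd :: "complex mat \<Rightarrow> bool" where
  "psd A \<longleftrightarrow> hermitian A \<and>
     (\<forall>v \<in> carrier_vec (dim_row A). 0 \<le> Re (cinner v (A *\<^sub>v v)))"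

definition spd :: "complex mat \<Rightarrow> bool" where
  "spd A \<longleftrightarrow> hermitian A \<and>
     (\<forall>v \<in> carrier_vec (dim_row A). v \<noteq> 0\<^sub>v (dim_row A) \<longrightarrow> 0 < Re (cinner v (A *\<^sub>v v)))"

definition unitary :: "complex mat \<Rightarrow> bool" where
  "unitary U \<longleftrightarrow> U \<in> carrier_mat (dim_row U) (dim_row U) \<and> adj U * U = 1\<^sub>m (dim_row U)"

definition rdiag :: "nat \<Rightarrow> (nat \<Rightarrow> real) \<Rightarrow> complex mat" where
  "rdiag n lam = mat n n (\<lambda>(i,j). if i = j then complex_of_real (lam i) else 0)"

definition mat_fun :: "(real \<Rightarrow> real) \<Rightarrow> complex mat \<Rightarrow> complex mat" where
  "mat_fun f A = (SOME B. \<exists>U lam. unitary U \<and> dim_row U = dim_row A \<and>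
       A = U * rdiag (dim_row A) lam * adj U \<and>
       B = U * rdiag (dim_row A) (f \<circ> lam) * adj U)"

definition msum :: "nat \<Rightarrow> 'x set \<Rightarrow> ('x \<Rightarrow> complex mat) \<Rightarrow> complex mat" where
  "msum n X f = mat n n (\<lambda>(a,b). \<Sum>x\<in>X. f x $$ (a,b))"

definition operator_monotone :: "(real \<Rightarrow> real) \<Rightarrow> bool" where
  "operator_monotone P \<longleftrightarrow>
     (\<forall>n A B. A \<in> carrier_mat n n \<longrightarrow> B \<in> carrier_mat n n \<longrightarrow> spd A \<longrightarrow> spd B \<longrightarrow>
        psd (B - A) \<longrightarrow> psd (mat_fun P B - mat_fun P A))"

text \<open>K^(P)_rho(X,Y) = Tr X* [(R_rho P(L_rho R_rho^{-1}))^{-1} Y], written out in an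
  eigenbasis of rho = U diag(lam) U*: the superoperator R_rho P(L_rho R_rho^{-1}) acts on
  the matrix unit |a><b| (in that basis) as multiplication by lam_b P(lam_a/lam_b).\<close>
definition mono_metric :: "(real \<Rightarrow> real) \<Rightarrow> complex mat \<Rightarrow> complex mat \<Rightarrow> complex mat \<Rightarrow> complex" where
  "mono_metric P rho X Y =
    (let n = dim_row rho;
         (U, lam) = (SOME (U, lam). unitary U \<and> dim_row U = n \<and> rho = U * rdiag n lam * adj U);
         X' = adj U * X * U; Y' = adj U * Y * U
     in \<Sum>a<n. \<Sum>b<n. cnj (X' $$ (a,b)) * Y' $$ (a,b) / complex_of_real (lam b * P (lam a / lam b)))"

definition P_beta :: "real \<Rightarrow> real \<Rightarrow> real" where
  "P_beta \<beta> x = (1 + \<beta>) / 2 * x + (1 - \<beta>) / 2"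

definition eidx :: "nat \<Rightarrow> 'd::finite" where
  "eidx = (SOME f. bij_betw f {..<CARD('d)} (UNIV :: 'd set))"

primrec Ck_on :: "nat \<Rightarrow> (real^'d) set \<Rightarrow> (real^'d \<Rightarrow> complex) \<Rightarrow> bool" where
  "Ck_on 0 S f = continuous_on S f"
| "Ck_on (Suc k) S f = (continuous_on S f \<and>
     (\<forall>i. \<exists>g. (\<forall>x\<in>S. ((\<lambda>t. f (x + t *\<^sub>R axis i 1)) has_vector_derivative g x) (at 0)) \<and> Ck_on k S g))"

definition smooth_on :: "(real^'d) set \<Rightarrow> (real^'d \<Rightarrow> complex) \<Rightarrow> bool" where
  "smooth_on S f \<longleftrightarrow> (\<forall>k. Ck_on k S f)"

definition density :: "nat \<Rightarrow> complex mat \<Rightarrow> bool" where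
  "density n A \<longleftrightarrow> A \<in> carrier_mat n n \<and> psd A \<and> mtrace A = 1"

definition pderiv_rho :: "(real^'d \<Rightarrow> complex mat) \<Rightarrow> real^'d \<Rightarrow> nat \<Rightarrow> complex mat" where
  "pderiv_rho rho \<theta>0 i = mat (dim_row (rho \<theta>0)) (dim_row (rho \<theta>0))
     (\<lambda>(a,b). vector_derivative (\<lambda>t. rho (\<theta>0 + t *\<^sub>R axis (eidx i) 1) $$ (a,b)) (at 0))"

definition is_POVM :: "nat \<Rightarrow> 'x set \<Rightarrow> ('x \<Rightarrow> complex mat) \<Rightarrow> bool" where
  "is_POVM n X M \<longleftrightarrow> finite X \<and> (\<forall>x\<in>X. M x \<in> carrier_mat n n \<and> psd (M x)) \<and>
     msum n X M = 1\<^sub>m n"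

definition locally_unbiased ::
  "(real^'d \<Rightarrow> complex mat) \<Rightarrow> real^'d \<Rightarrow> 'x set \<Rightarrow> ('x \<Rightarrow> complex mat) \<Rightarrow> ('x \<Rightarrow> real^'d) \<Rightarrow> bool" where
  "locally_unbiased rho \<theta>0 X M est \<longleftrightarrow>
     (\<forall>i<CARD('d). (\<Sum>x\<in>X. complex_of_real (est x $ eidx i) * mtrace (rho \<theta>0 * M x))
                     = complex_of_real (\<theta>0 $ eidx i)) \<and>
     (\<forall>i<CARD('d). \<forall>j<CARD('d). (\<Sum>x\<in>X. complex_of_real (est x $ eidx i) * mtrace (pderiv_rho rho \<theta>0 j * M x))
                     = (if i = j then 1 else 0))"

definition covariance ::
  "(real^'d \<Rightarrow> complex mat) \<Rightarrow> real^'d \<Rightarrow> 'x set \<Rightarrow> ('x \<Rightarrow> complex mat) \<Rightarrow> ('x \<Rightarrow> real^'d) \<Rightarrow> real mat" where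
  "covariance rho \<theta>0 X M est = mat CARD('d) CARD('d) (\<lambda>(i,j).
     \<Sum>x\<in>X. (est x $ eidx i - \<theta>0 $ eidx i) * (est x $ eidx j - \<theta>0 $ eidx j) * Re (mtrace (rho \<theta>0 * M x)))"

definition classical_fisher ::
  "(real^'d \<Rightarrow> complex mat) \<Rightarrow> real^'d \<Rightarrow> 'x set \<Rightarrow> ('x \<Rightarrow> complex mat) \<Rightarrow> real mat" where
  "classical_fisher rho \<theta>0 X M = mat CARD('d) CARD('d) (\<lambda>(i,j).
     \<Sum>x\<in>X. Re (mtrace (pderiv_rho rho \<theta>0 i * M x)) * Re (mtrace (pderiv_rho rho \<theta>0 j * M x))
            / Re (mtrace (rho \<theta>0 * M x)))"

definition quantum_fisher ::
  "(real \<Rightarrow> real) \<Rightarrow> (real^'d \<Rightarrow> complex mat) \<Rightarrow> real^'d \<Rightarrow> complex mat" where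
  "quantum_fisher P rho \<theta>0 = mat CARD('d) CARD('d) (\<lambda>(i,j).
     mono_metric P (rho \<theta>0) (pderiv_rho rho \<theta>0 i) (pderiv_rho rho \<theta>0 j))"

definition mat_abs :: "complex mat \<Rightarrow> complex mat" where
  "mat_abs A = mat_fun sqrt (adj A * A)"

definition rpsd :: "nat \<Rightarrow> real mat \<Rightarrow> bool" where
  "rpsd d G \<longleftrightarrow> G \<in> carrier_mat d d \<and> transpose_mat G = G \<and>
     (\<forall>v \<in> carrier_vec d. 0 \<le> v \<bullet> (G *\<^sub>v v))"

definition minv :: "'a::field mat \<Rightarrow> 'a mat" where
  "minv A = the (mat_inverse A)"

definition C_bound :: "real mat \<Rightarrow> complex mat \<Rightarrow> real" where
  "C_bound G J =
    (let Gc = map_mat complex_of_real G; Ji = minv J;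
         sG = mat_fun sqrt Gc;
         ImJi = map_mat (\<lambda>z. complex_of_real (Im z)) Ji
     in Re (mtrace (Gc * Ji)) + Re (mtrace (mat_abs (sG * ImJi * sG))))"

end

theory Submission
  imports Defs "Jordan_Normal_Form.Spectral_Radius"
begin

text \<open>
  The first inequality is the classical Cramer-Rao bound. For the others, the bound \<open>C\<close> is regarded as
  a function of the inverse Fisher matrix \<open>H\<close>: it is monotone in the Loewner order, invariant under
  entrywise conjugation, and equals \<open>Tr G H\<close> when \<open>H\<close> is real. Since inversion is antitone, it suffices
  to compare Fisher matrices. The matrix of the measurement is dominated by the one of
  \<open>P_beta \<bar>\<beta>\<bar>\<close> by Cauchy-Schwarz. An operator monotone function is concave, hence lies
  below its tangent \<open>P_beta \<beta>\<close> at 1, so the matrix of \<open>P\<close> dominates the one of \<open>P_beta \<beta>\<close>;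
  the matrix of \<open>P_beta (- \<beta>)\<close> is the conjugate of the latter, which accounts for the absolute value.
\<close>

unbundle no vec_syntax

section \<open>Complex matrices and the spectral theorem\<close>

text \<open>The obstacle is the matrix absolute value in the bound, which does not respect the
  Loewner order. What can be controlled is its trace: the trace of \<open>|T|\<close> is the least
  trace of a matrix dominating both \<open>T\<close> and \<open>- T\<close>. When \<open>H\<close>
  grows, the linear term \<open>Tr G H\<close> gains exactly the estimate for what the trace norm
  can lose.

  All Fisher matrices involved, classical, quantum and conjugated, are weighted Gram matrices. In an
  eigenbasis of the state the quantum ones share their vectors and differ only in the weights
  \<open>lam b * P (lam a / lam b)\<close>, so a pointwise bound on \<open>P\<close> is all that a
  comparison of two metrics needs. Conjugation swaps \<open>a\<close> and \<open>b\<close> in the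
  weight because the derivatives of the state are Hermitian.

  Matrix functions and the metric are defined by choosing a diagonalization. For matrix functions,
  independence of the choice is proved; for the metric, the chosen eigenbasis is fixed once and
  serves every \<open>P\<close>. Since division by 0 gives 0, the classical bound also needs the
  derivatives of the probabilities to vanish at outcomes of probability 0; Cauchy-Schwarz provides
  this.\<close>

lemma adj_dim [simp]: "dim_row (adj A) = dim_col A" "dim_col (adj A) = dim_row A"
  by (auto simp: adj_def)

lemma adj_index [simp]: "i < dim_col A \<Longrightarrow> j < dim_row A \<Longrightarrow> adj A $$ (i,j) = cnj (A $$ (j,i))"
  by (auto simp: adj_def)

lemma adj_carrier [simp]: "A \<in> carrier_mat n m \<Longrightarrow> adj A \<in> carrier_mat m n"
  by (auto simp: adj_def)

lemma adj_adj [simp]: "adj (adj A) = A"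
  by (rule eq_matI) auto

lemma index_mult_mat_sum:
  assumes "A \<in> carrier_mat n m" "B \<in> carrier_mat m k" "i < n" "j < k"
  shows "(A * B) $$ (i,j) = (\<Sum>l<m. A $$ (i,l) * B $$ (l,j))"
  using assms by (auto simp: scalar_prod_def atLeast0LessThan intro!: sum.cong)

lemma index_mult_mat_vec_sum:
  assumes "A \<in> carrier_mat n m" "v \<in> carrier_vec m" "i < n"
  shows "(A *\<^sub>v v) $ i = (\<Sum>l<m. A $$ (i,l) * v $ l)"
  using assms by (auto simp: scalar_prod_def atLeast0LessThan intro!: sum.cong)

lemma adj_mult:
  assumes "A \<in> carrier_mat n m" "B \<in> carrier_mat m k"
  shows "adj (A * B) = adj B * adj A"
proof (rule eq_matI)
  fix i j assume "i < dim_row (adj B * adj A)" "j < dim_col (adj B * adj A)"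
  then have ij: "i < k" "j < n" using assms by auto
  have "adj (A * B) $$ (i,j) = cnj (\<Sum>l<m. A $$ (j,l) * B $$ (l,i))"
    using assms ij by (subst index_mult_mat_sum[symmetric, OF assms]) auto
  also have "\<dots> = (\<Sum>l<m. adj B $$ (i,l) * adj A $$ (l,j))"
    using assms ij by (auto simp: mult.commute intro!: sum.cong)
  also have "\<dots> = (adj B * adj A) $$ (i,j)"
    using assms ij by (subst index_mult_mat_sum[of _ k m _ n]) auto
  finally show "adj (A * B) $$ (i,j) = (adj B * adj A) $$ (i,j)" .
qed (use assms in auto)

lemma adj_mult_dim: "dim_col A = dim_row B \<Longrightarrow> adj (A * B) = adj B * adj A"
  by (rule adj_mult[of A "dim_row A" "dim_col A" B "dim_col B"]) auto

lemma assoc_mult_mat_dim: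
  "dim_col A = dim_row B \<Longrightarrow> dim_col B = dim_row C \<Longrightarrow> A * B * C = A * (B * (C :: 'a::semiring_0 mat))"
  by (rule assoc_mult_mat[of A "dim_row A" "dim_col A" B "dim_col B" C "dim_col C"]) auto

lemma assoc_mult_mat_vec_dim:
  "dim_col A = dim_row B \<Longrightarrow> dim_col B = dim_vec v \<Longrightarrow> A * B *\<^sub>v v = A *\<^sub>v (B *\<^sub>v (v :: 'a::semiring_0 vec))"
  by (rule assoc_mult_mat_vec[of A "dim_row A" "dim_col A" B "dim_col B" v]) auto

lemma cinner_mult_mat:
  assumes "A \<in> carrier_mat n m" "v \<in> carrier_vec n" "w \<in> carrier_vec m"
  shows "cinner v (A *\<^sub>v w) = (\<Sum>i<n. \<Sum>j<m. cnj (v $ i) * A $$ (i,j) * w $ j)"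
proof -
  have "cinner v (A *\<^sub>v w) = (\<Sum>i<n. cnj (v $ i) * (A *\<^sub>v w) $ i)"
    using assms by (auto simp: cinner_def)
  also have "\<dots> = (\<Sum>i<n. \<Sum>j<m. cnj (v $ i) * A $$ (i,j) * w $ j)"
    by (intro sum.cong refl)
       (subst index_mult_mat_vec_sum[OF assms(1,3)], auto simp: sum_distrib_left mult.assoc)
  finally show ?thesis .
qed

lemma cinner_adj:
  assumes "A \<in> carrier_mat n m" "v \<in> carrier_vec n" "w \<in> carrier_vec m"
  shows "cinner v (A *\<^sub>v w) = cinner (adj A *\<^sub>v v) w"
proof -
  have "cinner (adj A *\<^sub>v v) w = (\<Sum>j<m. cnj ((adj A *\<^sub>v v) $ j) * w $ j)"
    using assms by (auto simp: cinner_def)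
  also have "\<dots> = (\<Sum>j<m. \<Sum>i<n. cnj (v $ i) * A $$ (i,j) * w $ j)"
  proof (intro sum.cong refl)
    fix j assume j: "j \<in> {..<m}"
    have "(adj A *\<^sub>v v) $ j = (\<Sum>i<n. adj A $$ (j,i) * v $ i)"
      using assms j by (intro index_mult_mat_vec_sum) auto
    also have "\<dots> = (\<Sum>i<n. cnj (A $$ (i,j)) * v $ i)"
      using assms j by (auto intro!: sum.cong)
    finally show "cnj ((adj A *\<^sub>v v) $ j) * w $ j = (\<Sum>i<n. cnj (v $ i) * A $$ (i,j) * w $ j)"
      by (auto simp: sum_distrib_right sum_distrib_left mult_ac)
  qed
  also have "\<dots> = cinner v (A *\<^sub>v w)"
    using cinner_mult_mat[OF assms] by (subst sum.swap) simp
  finally show ?thesis by simp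
qed

section \<open>Hermitian and positive semidefinite matrices\<close>

lemma hermitian_iff:
  assumes "A \<in> carrier_mat n n"
  shows "hermitian A \<longleftrightarrow> (\<forall>i<n. \<forall>j<n. cnj (A $$ (j,i)) = A $$ (i,j))"
  using assms by (auto simp: hermitian_def adj_def mat_eq_iff)

lemma hermitianD: "hermitian A \<Longrightarrow> adj A = A"
  by (simp add: hermitian_def)

lemma psd_iff:
  assumes "A \<in> carrier_mat n n"
  shows "psd A \<longleftrightarrow> hermitian A \<and>
    (\<forall>v \<in> carrier_vec n. 0 \<le> Re (\<Sum>i<n. \<Sum>j<n. cnj (v $ i) * A $$ (i,j) * v $ j))"
  using assms by (simp add: psd_def cinner_mult_mat)

lemma psd_imp_hermitian: "psd A \<Longrightarrow> hermitian A"
  by (simp add: psd_def)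

lemma psd_add:
  assumes "A \<in> carrier_mat n n" "B \<in> carrier_mat n n" "psd A" "psd B"
  shows "psd (A + B)"
  using assms by (auto simp: psd_iff[of _ n] hermitian_iff[of _ n] algebra_simps sum.distrib)

lemma psd_congruence:
  assumes A: "A \<in> carrier_mat n n" "psd A" and C: "C \<in> carrier_mat n m"
  shows "psd (adj C * A * C)"
proof -
  have car: "adj C * A * C \<in> carrier_mat m m" using A C by auto
  have "adj (adj C * A * C) = adj C * A * C"
    using A C by (simp add: adj_mult_dim assoc_mult_mat_dim hermitianD psd_imp_hermitian)
  moreover have "0 \<le> Re (cinner v ((adj C * A * C) *\<^sub>v v))" if v: "v \<in> carrier_vec m" for v
  proof -
    have "(adj C * A * C) *\<^sub>v v = adj C *\<^sub>v (A *\<^sub>v (C *\<^sub>v v))"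
      using A C v by (simp add: assoc_mult_mat_vec_dim)
    then have "cinner v ((adj C * A * C) *\<^sub>v v) = cinner (C *\<^sub>v v) (A *\<^sub>v (C *\<^sub>v v))"
      using cinner_adj[of "adj C" m n v "A *\<^sub>v (C *\<^sub>v v)"] A C v by simp
    then show ?thesis using A C v by (simp add: psd_def)
  qed
  ultimately show ?thesis using car by (auto simp: psd_def hermitian_def)
qed

text \<open>Conjugating the vector along with the matrix conjugates the value of the form, which
  leaves its real part unchanged.\<close>

lemma psd_map_cnj:
  assumes A: "A \<in> carrier_mat n n" "psd A"
  shows "psd (map_mat cnj A)"
proof -
  have car: "map_mat cnj A \<in> carrier_mat n n" using A by simp
  have "0 \<le> Re (\<Sum>i<n. \<Sum>j<n. cnj (v $ i) * map_mat cnj A $$ (i,j) * v $ j)"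
    if v: "v \<in> carrier_vec n" for v
  proof -
    define w where "w = map_vec cnj v"
    have "w \<in> carrier_vec n" using v by (simp add: w_def)
    then have "0 \<le> Re (\<Sum>i<n. \<Sum>j<n. cnj (w $ i) * A $$ (i,j) * w $ j)"
      using A psd_iff[of A n] by blast
    also have "(\<Sum>i<n. \<Sum>j<n. cnj (w $ i) * A $$ (i,j) * w $ j) =
        cnj (\<Sum>i<n. \<Sum>j<n. cnj (v $ i) * map_mat cnj A $$ (i,j) * v $ j)"
      using A v by (simp add: w_def)
    finally show ?thesis by (simp only: cnj.simps)
  qed
  moreover have "hermitian (map_mat cnj A)"
    using A by (simp add: hermitian_iff[OF car] hermitian_iff[OF A(1)] psd_def)
  ultimately show ?thesis unfolding psd_iff[OF car] by blast
qed

lemma psd_diag_nonneg: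
  assumes A: "A \<in> carrier_mat n n" "psd A" and k: "k < n"
  shows "0 \<le> Re (A $$ (k,k))"
proof -
  have "0 \<le> Re (\<Sum>i<n. \<Sum>j<n. cnj (unit_vec n k $ i) * A $$ (i,j) * unit_vec n k $ j)"
    using A psd_iff[of A n] by auto
  also have "(\<Sum>i<n. \<Sum>j<n. cnj (unit_vec n k $ i) * A $$ (i,j) * unit_vec n k $ j) =
     (\<Sum>i<n. if i = k then (\<Sum>j<n. if j = k then A $$ (i,j) else 0) else 0)"
    using k by (intro sum.cong refl) (auto simp: if_distrib[of "\<lambda>x. _ * x"] cong: if_cong)
  also have "\<dots> = A $$ (k,k)" using k by simp
  finally show ?thesis .
qed

lemma mtrace_mult_comm:
  assumes "A \<in> carrier_mat n m" "B \<in> carrier_mat m n"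
  shows "mtrace (A * B) = mtrace (B * A)"
proof -
  have "mtrace (A * B) = (\<Sum>i<n. \<Sum>j<m. A $$ (i,j) * B $$ (j,i))"
    using assms by (auto simp: mtrace_def scalar_prod_def atLeast0LessThan intro!: sum.cong)
  also have "\<dots> = (\<Sum>j<m. \<Sum>i<n. B $$ (j,i) * A $$ (i,j))"
    by (subst sum.swap) (simp add: mult.commute)
  also have "\<dots> = mtrace (B * A)"
    using assms by (auto simp: mtrace_def scalar_prod_def atLeast0LessThan intro!: sum.cong)
  finally show ?thesis .
qed

lemma mtrace_add:
  assumes "A \<in> carrier_mat n n" "B \<in> carrier_mat n n"
  shows "mtrace (A + B) = mtrace A + mtrace B"
  using assms by (simp add: mtrace_def sum.distrib)

lemma mtrace_mult:
  assumes "A \<in> carrier_mat n m" "B \<in> carrier_mat m n"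
  shows "mtrace (A * B) = (\<Sum>i<n. \<Sum>j<m. A $$ (i,j) * B $$ (j,i))"
  using assms by (auto simp: mtrace_def scalar_prod_def atLeast0LessThan intro!: sum.cong)

lemma unitaryD:
  assumes "unitary U" "dim_row U = n"
  shows "U \<in> carrier_mat n n" "adj U * U = 1\<^sub>m n" "U * adj U = 1\<^sub>m n"
proof -
  show U: "U \<in> carrier_mat n n" and 1: "adj U * U = 1\<^sub>m n"
    using assms by (auto simp: unitary_def)
  show "U * adj U = 1\<^sub>m n"
    by (rule mat_mult_left_right_inverse[OF _ U 1]) (use U in auto)
qed

lemma unitaryI: "U \<in> carrier_mat n n \<Longrightarrow> adj U * U = 1\<^sub>m n \<Longrightarrow> unitary U"
  by (auto simp: unitary_def)

lemma rdiag_carrier [simp]: "rdiag n f \<in> carrier_mat n n" "dim_row (rdiag n f) = n" "dim_col (rdiag n f) = n"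
  by (auto simp: rdiag_def)

lemma rdiag_index [simp]: "i < n \<Longrightarrow> j < n \<Longrightarrow> rdiag n f $$ (i,j) = (if i = j then complex_of_real (f i) else 0)"
  by (auto simp: rdiag_def)

lemma adj_rdiag [simp]: "adj (rdiag n f) = rdiag n f"
  by (rule eq_matI) auto

lemma rdiag_mult: "rdiag n f * rdiag n g = rdiag n (\<lambda>i. f i * g i)"
proof (rule eq_matI)
  fix i j assume ij: "i < dim_row (rdiag n (\<lambda>i. f i * g i))" "j < dim_col (rdiag n (\<lambda>i. f i * g i))"
  then have "(rdiag n f * rdiag n g) $$ (i,j) = (\<Sum>l<n. rdiag n f $$ (i,l) * rdiag n g $$ (l,j))"
    by (intro index_mult_mat_sum) auto
  also have "\<dots> = (\<Sum>l<n. if l = i then (if i = j then complex_of_real (f i * g i) else 0) else 0)"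
    using ij by (intro sum.cong) auto
  finally show "(rdiag n f * rdiag n g) $$ (i,j) = rdiag n (\<lambda>i. f i * g i) $$ (i,j)"
    using ij by simp
qed auto

text \<open>\<open>U\<close> may be rectangular: with a single column this computes the entries of a
  rank-one matrix.\<close>

lemma index_diag_conj:
  assumes U: "U \<in> carrier_mat m n" and ij: "i < m" "j < m"
  shows "(U * rdiag n f * adj U) $$ (i,j) = (\<Sum>k<n. complex_of_real (f k) * U $$ (i,k) * cnj (U $$ (j,k)))"
proof -
  have "(U * rdiag n f * adj U) $$ (i,j) = (\<Sum>k<n. (U * rdiag n f) $$ (i,k) * adj U $$ (k,j))"
    using assms by (intro index_mult_mat_sum) auto
  also have "\<dots> = (\<Sum>k<n. complex_of_real (f k) * U $$ (i,k) * cnj (U $$ (j,k)))"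
  proof (intro sum.cong refl)
    fix k assume k: "k \<in> {..<n}"
    have "(U * rdiag n f) $$ (i,k) = (\<Sum>l<n. U $$ (i,l) * rdiag n f $$ (l,k))"
      using assms k by (intro index_mult_mat_sum) auto
    also have "\<dots> = (\<Sum>l<n. if l = k then U $$ (i,k) * complex_of_real (f k) else 0)"
      using k by (intro sum.cong) auto
    finally show "(U * rdiag n f) $$ (i,k) * adj U $$ (k,j) =
        complex_of_real (f k) * U $$ (i,k) * cnj (U $$ (j,k))"
      using k assms by (simp add: mult_ac)
  qed
  finally show ?thesis .
qed

section \<open>Diagonalization of Hermitian matrices by deflation\<close>

lemma four_block_diag_mult:
  assumes "(A::'a::comm_ring_1 mat) \<in> carrier_mat 1 1" "B \<in> carrier_mat 1 1" "C \<in> carrier_mat n n" "D \<in> carrier_mat n n"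
  shows "four_block_mat A (0\<^sub>m 1 n) (0\<^sub>m n 1) C * four_block_mat B (0\<^sub>m 1 n) (0\<^sub>m n 1) D
     = four_block_mat (A * B) (0\<^sub>m 1 n) (0\<^sub>m n 1) (C * D)"
  using assms by (subst mult_four_block_mat[of _ 1 1 _ n _ n _ _ 1 _ n])
    auto

lemma adj_four_block_diag:
  assumes "A \<in> carrier_mat 1 1" "C \<in> carrier_mat n n"
  shows "adj (four_block_mat A (0\<^sub>m 1 n) (0\<^sub>m n 1) C) = four_block_mat (adj A) (0\<^sub>m 1 n) (0\<^sub>m n 1) (adj C)"
  by (rule eq_matI) (use assms in auto)

text \<open>A reflection that moves the first basis vector onto the line of \<open>v\<close>. Being
  self-adjoint and an involution, it acts on Hermitian matrices by unitary conjugation, which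
  replaces the completion of \<open>v\<close> to an orthonormal basis.\<close>

lemma householder_exists:
  assumes v: "v \<in> carrier_vec (Suc n)" "v \<noteq> 0\<^sub>v (Suc n)"
  shows "\<exists>W c. W \<in> carrier_mat (Suc n) (Suc n) \<and> adj W = W \<and> W * W = 1\<^sub>m (Suc n) \<and>
     W *\<^sub>v unit_vec (Suc n) 0 = c \<cdot>\<^sub>v v \<and> c \<noteq> 0"
proof -
  let ?N = "Suc n"
  define r where "r = (\<Sum>i<?N. (cmod (v $ i))\<^sup>2)"
  have r: "r > 0"
  proof -
    obtain i where i: "i < ?N" "v $ i \<noteq> 0" using v by (auto simp: vec_eq_iff)
    have "0 < (cmod (v $ i))\<^sup>2" using i by simp
    also have "\<dots> \<le> r" unfolding r_def by (rule member_le_sum) (use i in auto)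
    finally show ?thesis .
  qed
  define p where "p = (if v $ 0 = 0 then 1 else - cnj (v $ 0) / cmod (v $ 0))"
  have p: "cmod p = 1" "p * v $ 0 = - complex_of_real (cmod (v $ 0))"
    by (auto simp: p_def norm_divide complex_norm_square[symmetric] power2_eq_square mult.commute[of "cnj _"])
  define c where "c = p / complex_of_real (sqrt r)"
  have c0: "c \<noteq> 0" using r p by (auto simp: c_def)
  define s where "s = cmod (v $ 0) / sqrt r"
  have s: "s \<ge> 0" "c * v $ 0 = - complex_of_real s" using r p(2) by (auto simp: s_def c_def)
  \<comment> \<open>reflection in the hyperplane orthogonal to \<open>c v - e\<^sub>0\<close>; the phase of \<open>c\<close> keeps this vector away from 0\<close>
  define w where "w = (\<lambda>i. c * v $ i - (if i = 0 then 1 else 0))"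
  have w0: "w 0 = complex_of_real (- s - 1)" using s by (simp add: w_def)
  \<comment> \<open>\<open>c v\<close> is a unit vector with first entry \<open>- s\<close>, so
    subtracting the first basis vector gives squared norm \<open>1 + 2 s + 1\<close>.\<close>
  have ww: "(\<Sum>i<?N. w i * cnj (w i)) = complex_of_real (2 * (1 + s))"
  proof -
    have "(\<Sum>i<?N. w i * cnj (w i)) = (\<Sum>i<?N. (c * v $ i) * cnj (c * v $ i)
        + (if i = 0 then 1 - c * v $ 0 - cnj (c * v $ 0) else 0))"
      by (intro sum.cong) (auto simp: w_def algebra_simps)
    also have "\<dots> = (\<Sum>i<?N. (c * v $ i) * cnj (c * v $ i)) + (1 + 2 * complex_of_real s)"
      by (subst sum.distrib) (simp add: s(2) sum.lessThan_Suc_shift)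
    also have "(\<Sum>i<?N. (c * v $ i) * cnj (c * v $ i)) = c * cnj c * complex_of_real r"
      unfolding r_def of_real_sum sum_distrib_left
      by (intro sum.cong refl) (simp add: complex_norm_square[symmetric] mult_ac flip: of_real_power)
    also have "c * cnj c = complex_of_real (1 / r)"
      using r p(1) by (simp add: c_def complex_norm_square[symmetric] norm_divide power_divide flip: of_real_mult)
    finally show ?thesis using r by simp
  qed
  \<comment> \<open>The Householder factor: 2 divided by the squared norm of
    \<open>w\<close>.\<close>
  define u where "u = complex_of_real (1 / (1 + s))"
  have u: "cnj u = u" "u * (u * complex_of_real (2 * (1 + s))) = 2 * u"
  proof -
    show "cnj u = u" by (simp add: u_def)
    have "u * complex_of_real (2 * (1 + s)) = complex_of_real (1 / (1 + s) * (2 * (1 + s)))"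
      unfolding u_def by (rule of_real_mult[symmetric])
    also have "1 / (1 + s) * (2 * (1 + s)) = 2" using s(1) by (simp add: field_simps)
    finally show "u * (u * complex_of_real (2 * (1 + s))) = 2 * u" by simp
  qed
  \<comment> \<open>Hence the first column of \<open>W\<close> is the first basis vector plus
    \<open>w\<close>, which is \<open>c v\<close>.\<close>
  have uw0: "cnj (w 0) * u = - 1"
  proof -
    have "cnj (w 0) * u = complex_of_real ((- s - 1) * (1 / (1 + s)))"
      unfolding w0 u_def complex_cnj_complex_of_real by (rule of_real_mult[symmetric])
    also have "(- s - 1) * (1 / (1 + s)) = - 1" using s(1) by (simp add: field_simps)
    finally show ?thesis by simp
  qed
  define W where "W = mat ?N ?N (\<lambda>(i,j). (if i = j then 1 else 0) - w i * cnj (w j) * u)"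
  have W: "W \<in> carrier_mat ?N ?N" by (simp add: W_def)
  have adjW: "adj W = W" by (rule eq_matI) (auto simp: W_def u mult.commute)
  have WW: "W * W = 1\<^sub>m ?N"
  proof (rule eq_matI)
    fix i j assume "i < dim_row (1\<^sub>m ?N)" "j < dim_col (1\<^sub>m ?N)"
    then have ij: "i < ?N" "j < ?N" by auto
    define z where "z = w i * cnj (w j)"
    have "(W * W) $$ (i,j) = (\<Sum>l<?N. W $$ (i,l) * W $$ (l,j))"
      using W ij by (intro index_mult_mat_sum) auto
    also have "\<dots> = (\<Sum>l<?N. (if l = i then (if i = j then 1 else 0) - z * u else 0)
        - (if l = j then z * u else 0) + z * (u * (u * (w l * cnj (w l)))))"
      using ij by (intro sum.cong refl) (auto simp: W_def z_def ring_distribs)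
    also have "\<dots> = (if i = j then 1 else 0) - 2 * (z * u) + z * (u * (u * (\<Sum>l<?N. w l * cnj (w l))))"
      using ij by (simp add: sum.distrib sum_subtractf sum_distrib_left del: sum.lessThan_Suc)
    also have "\<dots> = (if i = j then 1 else 0)" unfolding ww u(2) by simp
    finally show "(W * W) $$ (i,j) = 1\<^sub>m ?N $$ (i,j)" using ij by simp
  qed (use W in auto)
  have "W *\<^sub>v unit_vec ?N 0 = c \<cdot>\<^sub>v v"
  proof (rule eq_vecI)
    fix i assume "i < dim_vec (c \<cdot>\<^sub>v v)"
    then have i: "i < ?N" using v by auto
    have "(W *\<^sub>v unit_vec ?N 0) $ i = W $$ (i,0)"
      using i W by simp
    also have "\<dots> = (if i = 0 then 1 else 0) + w i" using i uw0 by (simp add: W_def mult.assoc)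
    also have "\<dots> = (c \<cdot>\<^sub>v v) $ i" using i v by (simp add: w_def)
    finally show "(W *\<^sub>v unit_vec ?N 0) $ i = (c \<cdot>\<^sub>v v) $ i" .
  qed (use W v in auto)
  then show ?thesis using W adjW WW c0 by blast
qed

text \<open>A reflection moves an eigenvector to the first basis vector. Hermiticity then clears the
  first row along with the first column, and the induction hypothesis applies to the remaining
  block.\<close>

theorem spectral_theorem:
  assumes "A \<in> carrier_mat n n" "hermitian A"
  shows "\<exists>U lam. unitary U \<and> dim_row U = n \<and> A = U * rdiag n lam * adj U"
  using assms
proof (induction n arbitrary: A)
  case 0
  show ?case
    by (rule exI[of _ "1\<^sub>m 0"], rule exI[of _ "\<lambda>_. 0"]) (use 0 in \<open>auto simp: unitary_def\<close>)
next
  case (Suc n)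
  let ?N = "Suc n"
  from spectrum_non_empty[OF Suc.prems(1)] obtain e where "eigenvalue A e" by (auto simp: spectrum_def)
  then obtain v where v: "v \<in> carrier_vec ?N" "v \<noteq> 0\<^sub>v ?N" "A *\<^sub>v v = e \<cdot>\<^sub>v v"
    using Suc.prems(1) by (auto simp: eigenvalue_def eigenvector_def)
  obtain W c where W: "W \<in> carrier_mat ?N ?N" "adj W = W" "W * W = 1\<^sub>m ?N"
     "W *\<^sub>v unit_vec ?N 0 = c \<cdot>\<^sub>v v" "c \<noteq> 0" using householder_exists[OF v(1,2)] by blast
  define B where "B = W * A * W"
  have B: "B \<in> carrier_mat ?N ?N" using W Suc.prems by (auto simp: B_def)
  have adjB: "adj B = B"
    using W Suc.prems by (simp add: B_def adj_mult_dim hermitianD assoc_mult_mat_dim)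
  have "B *\<^sub>v unit_vec ?N 0 = W *\<^sub>v (A *\<^sub>v (W *\<^sub>v unit_vec ?N 0))"
    using W Suc.prems by (simp add: B_def assoc_mult_mat_vec[of _ ?N ?N _ ?N])
  also have "\<dots> = e \<cdot>\<^sub>v (W *\<^sub>v (W *\<^sub>v unit_vec ?N 0))"
    using W Suc.prems v by (simp add: mult_mat_vec[of _ ?N ?N] smult_smult_assoc mult.commute)
  also have "W *\<^sub>v (W *\<^sub>v unit_vec ?N 0) = unit_vec ?N 0"
    using W by (subst assoc_mult_mat_vec[symmetric, of _ ?N ?N _ ?N]) auto
  finally have col: "B *\<^sub>v unit_vec ?N 0 = e \<cdot>\<^sub>v unit_vec ?N 0" .
  have Bi0: "B $$ (i,0) = (if i = 0 then e else 0)" if "i < ?N" for i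
  proof -
    have "B $$ (i,0) = (B *\<^sub>v unit_vec ?N 0) $ i" using that B by simp
    then show ?thesis using that by (simp add: col)
  qed
  have herm: "B $$ (i,j) = cnj (B $$ (j,i))" if "i < ?N" "j < ?N" for i j
    using adj_index[of i B j] that B adjB by simp
  have B0i: "B $$ (0,i) = (if i = 0 then e else 0)" if "i < ?N" for i
    using herm[of 0 i] herm[of 0 0] Bi0[of i] Bi0[of 0] that by auto
  have ereal: "e = complex_of_real (Re e)"
    using herm[of 0 0] Bi0[of 0] by (simp add: complex_eq_iff)
  define A3 where "A3 = mat n n (\<lambda>(i,j). B $$ (Suc i, Suc j))"
  define E where "E = mat 1 1 (\<lambda>_. e)"
  have A3: "A3 \<in> carrier_mat n n" by (simp add: A3_def)
  have "hermitian A3"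
    unfolding hermitian_iff[OF A3] using herm[symmetric] by (auto simp: A3_def)
  from Suc.IH[OF A3 this] obtain U3 lam where U3: "unitary U3" "dim_row U3 = n" "A3 = U3 * rdiag n lam * adj U3"
    by blast
  note u3 = unitaryD[OF U3(1,2)]
  have Bblock: "B = four_block_mat E (0\<^sub>m 1 n) (0\<^sub>m n 1) A3"
  proof (rule eq_matI)
    fix i j assume "i < dim_row (four_block_mat E (0\<^sub>m 1 n) (0\<^sub>m n 1) A3)"
      "j < dim_col (four_block_mat E (0\<^sub>m 1 n) (0\<^sub>m n 1) A3)"
    then have "i < ?N" "j < ?N" by (auto simp: E_def A3_def)
    then show "B $$ (i,j) = four_block_mat E (0\<^sub>m 1 n) (0\<^sub>m n 1) A3 $$ (i,j)"
      by (cases i; cases j) (auto simp: E_def A3_def Bi0 B0i)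
  qed (use B in \<open>auto simp: E_def A3_def\<close>)
  define V where "V = four_block_mat (1\<^sub>m 1) (0\<^sub>m 1 n) (0\<^sub>m n 1) U3"
  define mu where "mu = (\<lambda>i. case i of 0 \<Rightarrow> Re e | Suc k \<Rightarrow> lam k)"
  have V: "V \<in> carrier_mat ?N ?N" using u3 by (auto simp: V_def)
  have adjone: "adj (1\<^sub>m 1) = 1\<^sub>m 1" by (rule eq_matI) auto
  have E: "E \<in> carrier_mat 1 1" by (simp add: E_def)
  have adjV: "adj V = four_block_mat (1\<^sub>m 1) (0\<^sub>m 1 n) (0\<^sub>m n 1) (adj U3)"
    unfolding V_def using u3 by (subst adj_four_block_diag) (auto simp: adjone)
  have mu: "rdiag ?N mu = four_block_mat E (0\<^sub>m 1 n) (0\<^sub>m n 1) (rdiag n lam)"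
    by (rule eq_matI) (auto simp: E_def mu_def ereal[symmetric] split: nat.split)
  have VV: "adj V * V = 1\<^sub>m ?N"
    unfolding adjV unfolding V_def using u3 by (subst four_block_diag_mult) auto
  have BV: "B = V * rdiag ?N mu * adj V"
    unfolding adjV mu unfolding V_def Bblock U3(3) using u3 E
    by (subst four_block_diag_mult, auto simp del: One_nat_def,
        subst four_block_diag_mult, auto simp del: One_nat_def)
  have U: "W * V \<in> carrier_mat ?N ?N" using W V by auto
  have "adj (W * V) * (W * V) = adj V * (W * W) * V"
    using W(1,2) V by (simp add: adj_mult_dim assoc_mult_mat_dim)
  also have "\<dots> = 1\<^sub>m ?N" using W(3) V VV by simp
  finally have "unitary (W * V)" by (rule unitaryI[OF U])
  moreover have "A = (W * V) * rdiag ?N mu * adj (W * V)"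
  proof -
    have "(W * V) * rdiag ?N mu * adj (W * V) = W * (V * rdiag ?N mu * adj V) * W"
      using W(1,2) V by (simp add: adj_mult_dim assoc_mult_mat_dim)
    also have "\<dots> = (W * W) * A * (W * W)"
      unfolding BV[symmetric] B_def using W(1) Suc.prems by (simp add: assoc_mult_mat_dim)
    also have "\<dots> = A" using W(3) Suc.prems by simp
    finally show ?thesis by simp
  qed
  ultimately show ?case using U by (intro exI[of _ "W * V"] exI[of _ mu]) auto
qed

section \<open>Functional calculus and the trace norm\<close>

lemma sandwich_carrier:
  "C \<in> carrier_mat k n \<Longrightarrow> A \<in> carrier_mat n m \<Longrightarrow> D \<in> carrier_mat m l \<Longrightarrow> C * A * D \<in> carrier_mat k l"
  by (intro mult_carrier_mat[of _ k m] mult_carrier_mat[of _ k n])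

lemma sandwich_linear:
  fixes A :: "'a::comm_ring_1 mat"
  assumes "C \<in> carrier_mat k n" "A \<in> carrier_mat n m" "B \<in> carrier_mat n m" "D \<in> carrier_mat m l"
  shows "C * (A + B) * D = C * A * D + C * B * D"
    "C * (A - B) * D = C * A * D - C * B * D"
    "C * (c \<cdot>\<^sub>m A) * D = c \<cdot>\<^sub>m (C * A * D)"
proof -
  have car: "C * A \<in> carrier_mat k m" "C * B \<in> carrier_mat k m"
    by (rule mult_carrier_mat[OF assms(1,2)], rule mult_carrier_mat[OF assms(1,3)])
  show "C * (A + B) * D = C * A * D + C * B * D"
    unfolding mult_add_distrib_mat[OF assms(1-3)] by (rule add_mult_distrib_mat[OF car assms(4)])
  show "C * (A - B) * D = C * A * D - C * B * D"
    unfolding mult_minus_distrib_mat[OF assms(1-3)] by (rule minus_mult_distrib_mat[OF car assms(4)])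
  show "C * (c \<cdot>\<^sub>m A) * D = c \<cdot>\<^sub>m (C * A * D)"
    unfolding mult_smult_distrib[OF assms(1,2)] by (rule mult_smult_assoc_mat[OF car(1) assms(4)])
qed

text \<open>The choice in \<open>mat_fun\<close> is harmless. Given two diagonalizations of
  \<open>A\<close>, the matrix \<open>R = adj W * U\<close> intertwines the two diagonal matrices,
  so \<open>R $$ (i,j)\<close> vanishes unless \<open>lam j = mu i\<close>. Therefore
  \<open>R\<close> also intertwines the diagonal matrices after \<open>f\<close> is applied.\<close>

lemma mat_fun_diag:
  assumes U: "unitary U" "dim_row U = n" and A: "A = U * rdiag n lam * adj U"
  shows "mat_fun f A = U * rdiag n (f \<circ> lam) * adj U"
proof -
  note u = unitaryD[OF U]
  have dimA: "dim_row A = n" using u A by simp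
  define Q where "Q B \<longleftrightarrow> (\<exists>U lam. unitary U \<and> dim_row U = dim_row A \<and>
       A = U * rdiag (dim_row A) lam * adj U \<and> B = U * rdiag (dim_row A) (f \<circ> lam) * adj U)" for B
  have "Q (U * rdiag n (f \<circ> lam) * adj U)" unfolding Q_def dimA using U A by blast
  then have "Q (mat_fun f A)" unfolding mat_fun_def Q_def by (rule someI)
  then obtain W mu where W: "unitary W" "dim_row W = n" "A = W * rdiag n mu * adj W"
    and B: "mat_fun f A = W * rdiag n (f \<circ> mu) * adj W"
    unfolding Q_def dimA by blast
  note w = unitaryD[OF W(1,2)]
  define R where "R = adj W * U"
  have R: "R \<in> carrier_mat n n" using u w by (auto simp: R_def)
  have "R * rdiag n lam = adj W * (U * rdiag n lam * adj U) * U"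
    using u w by (simp add: R_def assoc_mult_mat_dim)
  also have "\<dots> = adj W * (W * rdiag n mu * adj W) * U" using A W by simp
  also have "\<dots> = (adj W * W) * rdiag n mu * R"
    using u(1) w(1) by (simp add: R_def assoc_mult_mat_dim)
  finally have eq: "R * rdiag n lam = rdiag n mu * R" using w by simp
  have left: "(rdiag n g * R) $$ (i,j) = complex_of_real (g i) * R $$ (i,j)"
   and right: "(R * rdiag n g) $$ (i,j) = R $$ (i,j) * complex_of_real (g j)" if "i < n" "j < n" for g i j
  proof -
    have "(rdiag n g * R) $$ (i,j) = (\<Sum>l<n. rdiag n g $$ (i,l) * R $$ (l,j))"
      using that R by (intro index_mult_mat_sum) auto
    also have "\<dots> = (\<Sum>l<n. if l = i then complex_of_real (g i) * R $$ (i,j) else 0)"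
      using that by (intro sum.cong) auto
    finally show "(rdiag n g * R) $$ (i,j) = complex_of_real (g i) * R $$ (i,j)" using that by simp
    have "(R * rdiag n g) $$ (i,j) = (\<Sum>l<n. R $$ (i,l) * rdiag n g $$ (l,j))"
      using that R by (intro index_mult_mat_sum) auto
    also have "\<dots> = (\<Sum>l<n. if l = j then R $$ (i,j) * complex_of_real (g j) else 0)"
      using that by (intro sum.cong) auto
    finally show "(R * rdiag n g) $$ (i,j) = R $$ (i,j) * complex_of_real (g j)" using that by simp
  qed
  have eqf: "R * rdiag n (f \<circ> lam) = rdiag n (f \<circ> mu) * R"
  proof (rule eq_matI)
    fix i j assume "i < dim_row (rdiag n (f \<circ> mu) * R)" "j < dim_col (rdiag n (f \<circ> mu) * R)"
    then have ij: "i < n" "j < n" using R by auto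
    have "R $$ (i,j) * complex_of_real (lam j) = complex_of_real (mu i) * R $$ (i,j)"
      using arg_cong[OF eq, of "\<lambda>M. M $$ (i,j)"] ij by (simp only: left right)
    then have "R $$ (i,j) = 0 \<or> lam j = mu i" by auto
    then show "(R * rdiag n (f \<circ> lam)) $$ (i,j) = (rdiag n (f \<circ> mu) * R) $$ (i,j)"
      using ij by (auto simp only: left right o_def mult.commute mult_zero_left mult_zero_right)
  qed (use R in auto)
  have "U * rdiag n (f \<circ> lam) * adj U = (W * adj W) * U * rdiag n (f \<circ> lam) * adj U"
    using u(1) w(3) by simp
  also have "\<dots> = W * (R * rdiag n (f \<circ> lam)) * adj U"
    using u(1) w(1) by (simp add: R_def assoc_mult_mat_dim)
  also have "\<dots> = W * rdiag n (f \<circ> mu) * adj W * (U * adj U)"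
    using u(1) w(1) by (simp add: eqf) (simp add: R_def assoc_mult_mat_dim)
  also have "\<dots> = W * rdiag n (f \<circ> mu) * adj W" using u(1,3) w(1) by simp
  finally show ?thesis using B by simp
qed

lemma psd_rdiag:
  assumes "\<And>i. i < n \<Longrightarrow> 0 \<le> f i"
  shows "psd (rdiag n f)"
proof -
  have "(\<Sum>i<n. \<Sum>j<n. cnj (v $ i) * rdiag n f $$ (i,j) * v $ j) = complex_of_real (\<Sum>i<n. f i * (cmod (v $ i))\<^sup>2)" for v
  proof -
    have "(\<Sum>j<n. cnj (v $ i) * rdiag n f $$ (i,j) * v $ j) = complex_of_real (f i * (cmod (v $ i))\<^sup>2)" if "i < n" for i
    proof -
      have "(\<Sum>j<n. cnj (v $ i) * rdiag n f $$ (i,j) * v $ j) = (\<Sum>j<n. if j = i then complex_of_real (f i) * (v $ i * cnj (v $ i)) else 0)"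
        using that by (intro sum.cong) auto
      also have "\<dots> = complex_of_real (f i * (cmod (v $ i))\<^sup>2)"
        using that by (simp add: complex_norm_square[symmetric])
      finally show ?thesis .
    qed
    then show ?thesis by simp
  qed
  then show ?thesis using assms
    by (auto simp: psd_iff[of _ n] hermitian_iff[of _ n] intro!: sum_nonneg)
qed

lemma psd_diag_conj:
  assumes "U \<in> carrier_mat m n" "\<And>i. i < n \<Longrightarrow> 0 \<le> f i"
  shows "psd (U * rdiag n f * adj U)"
  using psd_congruence[OF _ psd_rdiag, of n f n "adj U" m] assms by simp

lemma diag_conj_diff:
  assumes "U \<in> carrier_mat m n"
  shows "U * rdiag n f * adj U - U * rdiag n g * adj U = U * rdiag n (\<lambda>i. f i - g i) * adj U"
  by (rule eq_matI)
     (use assms in \<open>auto simp: index_diag_conj[of U m n] sum_subtractf algebra_simps simp del: index_mult_mat(1)\<close>)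

lemma diag_conj_add:
  assumes "U \<in> carrier_mat m n"
  shows "U * rdiag n f * adj U + U * rdiag n g * adj U = U * rdiag n (\<lambda>i. f i + g i) * adj U"
  by (rule eq_matI)
     (use assms in \<open>auto simp: index_diag_conj[of U m n] sum.distrib algebra_simps simp del: index_mult_mat(1)\<close>)

lemma diag_conj_mult:
  assumes "unitary U" "dim_row U = n"
  shows "(U * rdiag n f * adj U) * (U * rdiag n g * adj U) = U * rdiag n (\<lambda>i. f i * g i) * adj U"
proof -
  note u = unitaryD[OF assms]
  have "(U * rdiag n f * adj U) * (U * rdiag n g * adj U) = U * (rdiag n f * (adj U * U) * rdiag n g) * adj U"
    using u(1) by (simp add: assoc_mult_mat_dim)
  then show ?thesis using u by (simp add: rdiag_mult)
qed

lemma mtrace_unitary_conj: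
  assumes "unitary U" "dim_row U = n" "A \<in> carrier_mat n n"
  shows "mtrace (U * A * adj U) = mtrace A" "mtrace (adj U * A * U) = mtrace A"
proof -
  note u = unitaryD[OF assms(1,2)]
  have "mtrace (U * A * adj U) = mtrace (adj U * (U * A))"
    using u assms by (intro mtrace_mult_comm) auto
  also have "adj U * (U * A) = (adj U * U) * A" using u(1) assms by (simp add: assoc_mult_mat_dim)
  finally show "mtrace (U * A * adj U) = mtrace A" using u assms by simp
  have "mtrace (adj U * A * U) = mtrace (U * (adj U * A))"
    using u assms by (intro mtrace_mult_comm) auto
  also have "U * (adj U * A) = (U * adj U) * A" using u(1) assms by (simp add: assoc_mult_mat_dim)
  finally show "mtrace (adj U * A * U) = mtrace A" using u assms by simp
qed

section \<open>The trace norm as a minimum of traces\<close>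

lemma mat_abs_hermitian:
  assumes T: "T \<in> carrier_mat n n" "hermitian T"
  shows "\<exists>U t. unitary U \<and> dim_row U = n \<and> T = U * rdiag n t * adj U \<and> mat_abs T = U * rdiag n (\<lambda>i. \<bar>t i\<bar>) * adj U"
proof -
  obtain U t where U: "unitary U" "dim_row U = n" "T = U * rdiag n t * adj U"
    using spectral_theorem[OF T] by blast
  have "adj T * T = U * rdiag n (\<lambda>i. t i * t i) * adj U"
    using T(2) diag_conj_mult[OF U(1,2), of t t] U(3) by (simp add: hermitianD)
  then have "mat_abs T = U * rdiag n (sqrt \<circ> (\<lambda>i. t i * t i)) * adj U"
    unfolding mat_abs_def by (intro mat_fun_diag[OF U(1,2)])
  also have "sqrt \<circ> (\<lambda>i. t i * t i) = (\<lambda>i. \<bar>t i\<bar>)" by auto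
  finally show ?thesis using U by blast
qed

text \<open>The absolute value is itself a common upper bound of \<open>T\<close> and
  \<open>- T\<close>; by \<open>trace_abs_le\<close> it has the least trace among all of
  them.\<close>

lemma mat_abs_dominates:
  assumes T: "T \<in> carrier_mat n n" "hermitian T"
  shows "mat_abs T \<in> carrier_mat n n" "psd (mat_abs T - T)" "psd (mat_abs T + T)"
proof -
  obtain U t where U: "unitary U" "dim_row U = n" "T = U * rdiag n t * adj U"
     "mat_abs T = U * rdiag n (\<lambda>i. \<bar>t i\<bar>) * adj U"
    using mat_abs_hermitian[OF T] by blast
  note u = unitaryD(1)[OF U(1,2)]
  show "mat_abs T \<in> carrier_mat n n" using u U(4) by auto
  have "mat_abs T - T = U * rdiag n (\<lambda>i. \<bar>t i\<bar> - t i) * adj U"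
    unfolding U(4) diag_conj_diff[OF u, symmetric] by (simp add: U(3)[symmetric])
  then show "psd (mat_abs T - T)" by (simp add: psd_diag_conj[OF u])
  have "mat_abs T + T = U * rdiag n (\<lambda>i. \<bar>t i\<bar> + t i) * adj U"
    unfolding U(4) diag_conj_add[OF u, symmetric] by (simp add: U(3)[symmetric])
  then show "psd (mat_abs T + T)" by (simp add: psd_diag_conj[OF u])
qed

text \<open>In an eigenbasis of \<open>T\<close> the two assumptions bound each diagonal entry of
  \<open>S\<close> from below by \<open>t i\<close> and by \<open>- t i\<close>, hence by the
  absolute value of \<open>t i\<close>; these add up to the trace norm.\<close>

lemma trace_abs_le:
  assumes T: "T \<in> carrier_mat n n" "hermitian T" and S: "S \<in> carrier_mat n n"
    and m: "psd (S - T)" and p: "psd (S + T)"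
  shows "Re (mtrace (mat_abs T)) \<le> Re (mtrace S)"
proof -
  obtain U t where U: "unitary U" "dim_row U = n" "T = U * rdiag n t * adj U"
     "mat_abs T = U * rdiag n (\<lambda>i. \<bar>t i\<bar>) * adj U"
    using mat_abs_hermitian[OF T] by blast
  note u = unitaryD[OF U(1,2)]
  define S' where "S' = adj U * S * U"
  have S': "S' \<in> carrier_mat n n" using u S by (auto simp: S'_def)
  have T': "adj U * T * U = rdiag n t"
  proof -
    have "adj U * T * U = (adj U * U) * rdiag n t * (adj U * U)"
      using u(1) by (simp add: U(3) assoc_mult_mat_dim)
    then show ?thesis using u by simp
  qed
  have "psd (adj U * (S - T) * U)" by (rule psd_congruence[OF _ m u(1)]) (use S T in auto)
  moreover have "adj U * (S - T) * U = S' - rdiag n t"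
    unfolding T'[symmetric] S'_def by (rule sandwich_linear) (use u(1) S T in auto)
  ultimately have m': "psd (S' - rdiag n t)" by simp
  have "psd (adj U * (S + T) * U)" by (rule psd_congruence[OF _ p u(1)]) (use S T in auto)
  moreover have "adj U * (S + T) * U = S' + rdiag n t"
    unfolding T'[symmetric] S'_def by (rule sandwich_linear) (use u(1) S T in auto)
  ultimately have p': "psd (S' + rdiag n t)" by simp
  have "\<bar>t i\<bar> \<le> Re (S' $$ (i,i))" if "i < n" for i
    using psd_diag_nonneg[OF minus_carrier_mat[OF rdiag_carrier(1)] m' that] psd_diag_nonneg[OF _ p' that] S' that by auto
  then have "(\<Sum>i<n. \<bar>t i\<bar>) \<le> Re (mtrace S')"
    using S' by (auto simp: mtrace_def intro!: sum_mono)
  moreover have "mtrace S' = mtrace S" unfolding S'_def using mtrace_unitary_conj[OF U(1,2) S] by simp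
  moreover have "mtrace (mat_abs T) = complex_of_real (\<Sum>i<n. \<bar>t i\<bar>)"
    unfolding U(4) by (subst mtrace_unitary_conj[OF U(1,2)]) (auto simp: mtrace_def)
  ultimately show ?thesis by simp
qed

lemma mat_fun_sqrt:
  assumes A: "A \<in> carrier_mat n n" "psd A"
  shows "mat_fun sqrt A \<in> carrier_mat n n" "adj (mat_fun sqrt A) = mat_fun sqrt A"
    "mat_fun sqrt A * mat_fun sqrt A = A"
proof -
  obtain U t where U: "unitary U" "dim_row U = n" "A = U * rdiag n t * adj U"
    using spectral_theorem[OF A(1)] A(2) by (auto simp: psd_def)
  note u = unitaryD[OF U(1,2)]
  have t: "t i \<ge> 0" if "i < n" for i
  proof -
    have "adj U * A * U = (adj U * U) * rdiag n t * (adj U * U)"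
      using u(1) by (simp add: U(3) assoc_mult_mat_dim)
    then have "adj U * A * U = rdiag n t" using u by simp
    moreover have "psd (adj U * A * U)" by (rule psd_congruence[OF A u(1)])
    ultimately show ?thesis using psd_diag_nonneg[of "rdiag n t" n i] that by simp
  qed
  have B: "mat_fun sqrt A = U * rdiag n (sqrt \<circ> t) * adj U" by (rule mat_fun_diag[OF U])
  show "mat_fun sqrt A \<in> carrier_mat n n" using u B by auto
  show "adj (mat_fun sqrt A) = mat_fun sqrt A"
    using u(1) by (simp add: B adj_mult_dim assoc_mult_mat_dim)
  have "rdiag n (\<lambda>i. (sqrt \<circ> t) i * (sqrt \<circ> t) i) = rdiag n t"
    using t by (intro eq_matI) (auto simp flip: of_real_mult)
  then show "mat_fun sqrt A * mat_fun sqrt A = A"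
    unfolding B diag_conj_mult[OF U(1,2)] by (simp add: U(3))
qed

text \<open>The bound \<open>C_bound G J\<close> as a function of \<open>H = J\<^sup>-\<^sup>1\<close>, in which it is monotone.\<close>

definition C_value :: "real mat \<Rightarrow> complex mat \<Rightarrow> real" where
  "C_value G H = Re (mtrace (map_mat complex_of_real G * H)) + Re (mtrace (mat_abs
     (mat_fun sqrt (map_mat complex_of_real G) * map_mat (\<lambda>z. complex_of_real (Im z)) H * mat_fun sqrt (map_mat complex_of_real G))))"

lemma C_bound_eq_C_value: "C_bound G J = C_value G (minv J)"
  by (simp add: C_bound_def C_value_def Let_def)

text \<open>For Hermitian \<open>H\<close> the matrix inside the absolute value of the bound is
  anti-Hermitian. The factor \<open>\<i>\<close> makes it Hermitian, so that
  \<open>mat_abs_dominates\<close> and \<open>trace_abs_le\<close> apply.\<close>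

lemma mat_abs_smult_ii: "mat_abs (\<i> \<cdot>\<^sub>m K) = mat_abs K"
proof -
  have "adj (\<i> \<cdot>\<^sub>m K) * (\<i> \<cdot>\<^sub>m K) = adj K * K"
    by (rule eq_matI) (auto simp: scalar_prod_def complex_eq_iff intro!: sum.cong)
  then show ?thesis by (simp add: mat_abs_def)
qed

lemma mat_abs_uminus: "mat_abs (- K) = mat_abs K"
proof -
  have "adj (- K) * (- K) = adj K * K"
    by (rule eq_matI) (auto simp: scalar_prod_def sum_negf)
  then show ?thesis by (simp add: mat_abs_def)
qed

lemma rpsd_form_nonneg:
  assumes "rpsd d G"
  shows "0 \<le> (\<Sum>i<d. \<Sum>j<d. f i * G $$ (i,j) * f j)"
proof -
  have G: "G \<in> carrier_mat d d" using assms by (auto simp: rpsd_def)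
  have "0 \<le> vec d f \<bullet> (G *\<^sub>v vec d f)" using assms by (auto simp: rpsd_def)
  also have "\<dots> = (\<Sum>i<d. \<Sum>j<d. f i * G $$ (i,j) * f j)"
    using G by (auto simp: scalar_prod_def atLeast0LessThan sum_distrib_left mult.assoc intro!: sum.cong)
  finally show ?thesis .
qed

text \<open>The cross terms between real and imaginary parts of a complex vector are purely
  imaginary, so the real part of the form splits into two real forms.\<close>

lemma psd_of_rpsd:
  assumes "rpsd d G"
  shows "map_mat complex_of_real G \<in> carrier_mat d d" "psd (map_mat complex_of_real G)"
proof -
  have G: "G \<in> carrier_mat d d" "transpose_mat G = G" using assms by (auto simp: rpsd_def)
  have sym: "G $$ (j,i) = G $$ (i,j)" if "i < d" "j < d" for i j
    using index_transpose_mat(1)[of i G j] G that by simp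
  show car: "map_mat complex_of_real G \<in> carrier_mat d d" using G by simp
  have "0 \<le> Re (\<Sum>i<d. \<Sum>j<d. cnj (v $ i) * map_mat complex_of_real G $$ (i,j) * v $ j)" for v
  proof -
    have "Re (\<Sum>i<d. \<Sum>j<d. cnj (v $ i) * map_mat complex_of_real G $$ (i,j) * v $ j) =
       (\<Sum>i<d. \<Sum>j<d. Re (v $ i) * G $$ (i,j) * Re (v $ j)) + (\<Sum>i<d. \<Sum>j<d. Im (v $ i) * G $$ (i,j) * Im (v $ j))"
      unfolding Re_sum sum.distrib[symmetric] using G by (intro sum.cong refl) (simp add: ring_distribs)
    then show ?thesis using rpsd_form_nonneg[OF assms, of "\<lambda>i. Re (v $ i)"] rpsd_form_nonneg[OF assms, of "\<lambda>i. Im (v $ i)"] by simp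
  qed
  then show "psd (map_mat complex_of_real G)"
    using G sym unfolding psd_iff[OF car] hermitian_iff[OF car] by simp
qed

lemma Re_mtrace_real_mult:
  assumes "G \<in> carrier_mat d d" "H \<in> carrier_mat d d"
  shows "Re (mtrace (map_mat complex_of_real G * H)) = (\<Sum>i<d. \<Sum>j<d. G $$ (i,j) * Re (H $$ (j,i)))"
  using assms by (simp add: mtrace_mult[of _ d d])

text \<open>Only the real part of \<open>H\<close> enters the real part of the trace with
  \<open>G\<close>, and conjugation keeps it; the imaginary part changes sign, which the absolute
  value ignores.\<close>

lemma C_value_map_cnj:
  assumes G: "rpsd d G" and H: "H \<in> carrier_mat d d"
  shows "C_value G (map_mat cnj H) = C_value G H"
proof -
  let ?s = "mat_fun sqrt (map_mat complex_of_real G)"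
  have Gc: "G \<in> carrier_mat d d" using G by (simp add: rpsd_def)
  have s: "?s \<in> carrier_mat d d" by (rule mat_fun_sqrt(1)[OF psd_of_rpsd[OF G]])
  have "map_mat (\<lambda>z. complex_of_real (Im z)) (map_mat cnj H) = - map_mat (\<lambda>z. complex_of_real (Im z)) H"
    by (rule eq_matI) auto
  then show ?thesis
    unfolding C_value_def using H Gc s by (simp add: Re_mtrace_real_mult[of G d] mat_abs_uminus)
qed

lemma C_value_of_real:
  assumes G: "rpsd d G" and V: "V \<in> carrier_mat d d"
  shows "C_value G (map_mat complex_of_real V) = mtrace (G * V)"
proof -
  let ?s = "mat_fun sqrt (map_mat complex_of_real G)"
  have Gc: "G \<in> carrier_mat d d" using G by (simp add: rpsd_def)
  have s: "?s \<in> carrier_mat d d" by (rule mat_fun_sqrt(1)[OF psd_of_rpsd[OF G]])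
  have 0: "map_mat (\<lambda>z. complex_of_real (Im z)) (map_mat complex_of_real V) = 0\<^sub>m d d"
    by (rule eq_matI) (use V in auto)
  have T0: "hermitian (0\<^sub>m d d)" by (simp add: hermitian_iff[of _ d])
  have z: "0\<^sub>m d d - 0\<^sub>m d d = (0\<^sub>m d d :: complex mat)" "0\<^sub>m d d + 0\<^sub>m d d = (0\<^sub>m d d :: complex mat)" by auto
  have p0: "psd (0\<^sub>m d d)" using T0 by (simp add: psd_iff[of _ d])
  \<comment> \<open>The trace of the absolute value of 0 is pinned from both sides, without
    computing a chosen diagonalization: 0 dominates \<open>0\<close> and \<open>- 0\<close>, and the
    absolute value is positive.\<close>
  have "Re (mtrace (mat_abs (0\<^sub>m d d))) \<le> 0"
    using trace_abs_le[OF _ T0, of d "0\<^sub>m d d"] p0 by (simp add: z mtrace_def)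
  moreover have "0 \<le> Re (mtrace (mat_abs (0\<^sub>m d d)))"
  proof -
    have "psd (mat_abs (0\<^sub>m d d))" using mat_abs_dominates[OF _ T0, of d] by simp
    then show ?thesis using psd_diag_nonneg[OF mat_abs_dominates(1)[OF _ T0, of d]]
      mat_abs_dominates(1)[OF _ T0, of d] by (auto simp: mtrace_def intro!: sum_nonneg)
  qed
  ultimately show ?thesis
    unfolding C_value_def 0 using s V Gc by (simp add: Re_mtrace_real_mult[of G d] mtrace_mult[of _ d d])
qed

text \<open>If \<open>T\<^sub>H\<close> denotes \<open>\<i> \<surd>G Im H \<surd>G\<close>, then \<open>\<surd>G Re (B - A) \<surd>G\<close> dominates both \<open>T\<^sub>B - T\<^sub>A\<close> and its negative
  (pass to the entrywise conjugate of \<open>B - A\<close>), so \<open>|T\<^sub>B| + \<surd>G Re (B - A) \<surd>G\<close> dominates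
  both \<open>T\<^sub>A\<close> and \<open>- T\<^sub>A\<close>.\<close>

lemma C_value_mono:
  assumes G: "rpsd d G" and A: "A \<in> carrier_mat d d" "hermitian A" and B: "B \<in> carrier_mat d d" "hermitian B"
    and AB: "psd (B - A)"
  shows "C_value G A \<le> C_value G B"
proof -
  define s where "s = mat_fun sqrt (map_mat complex_of_real G)"
  define re where "re = map_mat (\<lambda>z. complex_of_real (Re z))"
  define im where "im = map_mat (\<lambda>z. complex_of_real (Im z))"
  define T where "T H = \<i> \<cdot>\<^sub>m (s * im H * s)" for H
  define S where "S = s * re (B - A) * s"
  note Gc = psd_of_rpsd[OF G]
  have Gcar: "G \<in> carrier_mat d d" using G by (simp add: rpsd_def)
  have s: "s \<in> carrier_mat d d" "adj s = s" "s * s = map_mat complex_of_real G"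
    unfolding s_def by (rule mat_fun_sqrt[OF Gc])+
  have im: "im H \<in> carrier_mat d d" "re H \<in> carrier_mat d d" if "H \<in> carrier_mat d d" for H
    using that by (auto simp: im_def re_def)
  have Tcar: "T H \<in> carrier_mat d d" if "H \<in> carrier_mat d d" for H
    unfolding T_def by (rule smult_carrier_mat[OF sandwich_carrier[OF s(1) im(1)[OF that] s(1)]])
  have BA: "B - A \<in> carrier_mat d d" using A B by auto
  have Scar: "S \<in> carrier_mat d d" unfolding S_def by (rule sandwich_carrier[OF s(1) im(2)[OF BA] s(1)])
  have Therm: "hermitian (T H)" if H: "H \<in> carrier_mat d d" "hermitian H" for H
  proof -
    have "cnj (H $$ (j,i)) = H $$ (i,j)" if "i < d" "j < d" for i j
      using H that by (simp add: hermitian_iff[OF H(1)])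
    then have imH: "Im (H $$ (j,i)) = - Im (H $$ (i,j))" if "i < d" "j < d" for i j
      using that by (metis cnj.simps(2))
    have im': "adj (im H) = - im H"
    proof (rule eq_matI)
      fix i j assume "i < dim_row (- im H)" "j < dim_col (- im H)"
      then have "i < d" "j < d" using H by (auto simp: im_def)
      then show "adj (im H) $$ (i,j) = (- im H) $$ (i,j)" using imH[of i j] H by (simp add: im_def)
    qed (use H in \<open>auto simp: im_def\<close>)
    have sm: "adj (c \<cdot>\<^sub>m K) = cnj c \<cdot>\<^sub>m adj K" for c K by (rule eq_matI) auto
    have "adj (T H) = T H"
      using im[OF H(1)] s(1) unfolding T_def sm
      by (simp add: s(2) adj_mult_dim im' assoc_mult_mat_dim) (rule eq_matI, auto)
    then show ?thesis using Tcar[OF H(1)] by (simp add: hermitian_def)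
  qed
  have lin: "s * (X + c \<cdot>\<^sub>m Y) * s = s * X * s + c \<cdot>\<^sub>m (s * Y * s)"
    if "X \<in> carrier_mat d d" "Y \<in> carrier_mat d d" for X Y c
    using that s(1) by (simp add: sandwich_linear[of s d d])
  \<comment> \<open>Both identities rest on \<open>s * (B - A) * s = S + (T B - T A)\<close> and,
    for the conjugate, on \<open>S - (T B - T A)\<close>.\<close>
  have eqm: "mat_abs (T B) + S - T A = (mat_abs (T B) - T B) + s * (B - A) * s"
   and eqp: "mat_abs (T B) + S + T A = (mat_abs (T B) + T B) + s * map_mat cnj (B - A) * s"
  proof -
    have r1: "B - A = re (B - A) + \<i> \<cdot>\<^sub>m im (B - A)"
      and r2: "map_mat cnj (B - A) = re (B - A) + (- \<i>) \<cdot>\<^sub>m im (B - A)"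
      and r3: "im (B - A) = im B + (- 1) \<cdot>\<^sub>m im A"
      using A B by (auto simp: re_def im_def complex_eq_iff intro!: eq_matI)
    have i3: "s * im (B - A) * s = s * im B * s + (- 1) \<cdot>\<^sub>m (s * im A * s)"
      unfolding r3 using im A B by (intro lin) auto
    have sBA: "s * (B - A) * s = S + \<i> \<cdot>\<^sub>m (s * im (B - A) * s)"
      unfolding S_def by (subst r1, rule lin) (use im BA in auto)
    have sBA': "s * map_mat cnj (B - A) * s = S + (- \<i>) \<cdot>\<^sub>m (s * im (B - A) * s)"
      unfolding S_def by (subst r2, rule lin) (use im BA in auto)
    have K: "s * im A * s \<in> carrier_mat d d" "s * im B * s \<in> carrier_mat d d"
      by (rule sandwich_carrier[OF s(1) im(1) s(1)], rule A B)+
    have lin': "M + S' - \<i> \<cdot>\<^sub>m K = (M - \<i> \<cdot>\<^sub>m L) + (S' + \<i> \<cdot>\<^sub>m (L + (- 1) \<cdot>\<^sub>m K))"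
      "M + S' + \<i> \<cdot>\<^sub>m K = (M + \<i> \<cdot>\<^sub>m L) + (S' + (- \<i>) \<cdot>\<^sub>m (L + (- 1) \<cdot>\<^sub>m K))"
      if "M \<in> carrier_mat d d" "S' \<in> carrier_mat d d" "K \<in> carrier_mat d d" "L \<in> carrier_mat d d"
      for M S' K L :: "complex mat"
      using that by (auto intro!: eq_matI simp: ring_distribs)
    note car = mat_abs_dominates(1)[OF Tcar Therm, OF B(1) B] Scar K
    show "mat_abs (T B) + S - T A = (mat_abs (T B) - T B) + s * (B - A) * s"
      using lin'(1)[OF car] unfolding sBA i3 T_def .
    show "mat_abs (T B) + S + T A = (mat_abs (T B) + T B) + s * map_mat cnj (B - A) * s"
      using lin'(2)[OF car] unfolding sBA' i3 T_def .
  qed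
  note ab = mat_abs_dominates[OF Tcar[OF B(1)] Therm[OF B]]
  have c1: "psd (s * (B - A) * s)" using psd_congruence[OF BA AB s(1)] s(2) by simp
  have c2: "psd (s * map_mat cnj (B - A) * s)"
    using psd_congruence[OF _ psd_map_cnj[OF BA AB] s(1)] s(2) BA by simp
  have "Re (mtrace (mat_abs (T A))) \<le> Re (mtrace (mat_abs (T B) + S))"
  proof (rule trace_abs_le[OF Tcar[OF A(1)] Therm[OF A]])
    show "mat_abs (T B) + S \<in> carrier_mat d d" using ab Scar by simp
    show "psd (mat_abs (T B) + S - T A)" unfolding eqm
      by (rule psd_add[OF _ _ ab(2) c1]) (use ab Tcar[OF B(1)] s BA in auto)
    show "psd (mat_abs (T B) + S + T A)" unfolding eqp
      by (rule psd_add[OF _ _ ab(3) c2]) (use ab Tcar[OF B(1)] s BA in auto)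
  qed
  also have "\<dots> = Re (mtrace (mat_abs (T B))) + Re (mtrace S)"
    using ab Scar by (simp add: mtrace_add[of _ d])
  \<comment> \<open>By cyclicity the cost \<open>mtrace S\<close> of passing from \<open>T A\<close>
    to \<open>T B\<close> equals the increase of the linear term from \<open>A\<close> to
    \<open>B\<close>.\<close>
  also have "mtrace S = mtrace (map_mat complex_of_real G * re (B - A))"
  proof -
    have "mtrace S = mtrace (s * (s * re (B - A)))"
      unfolding S_def using s im(2)[OF BA] by (intro mtrace_mult_comm) auto
    also have "s * (s * re (B - A)) = map_mat complex_of_real G * re (B - A)"
      unfolding s(3)[symmetric] using s(1) im(2)[OF BA] by (simp add: assoc_mult_mat_dim)
    finally show ?thesis .
  qed
  also have "Re \<dots> = Re (mtrace (map_mat complex_of_real G * B)) - Re (mtrace (map_mat complex_of_real G * A))"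
    using Gcar A B im(2)[OF BA]
    by (simp add: Re_mtrace_real_mult[of G d] re_def sum_subtractf[symmetric] algebra_simps)
  finally show ?thesis unfolding C_value_def s_def[symmetric] im_def[symmetric]
    by (simp add: T_def mat_abs_smult_ii)
qed

lemma unitary_one [simp]: "unitary (1\<^sub>m n)" "adj (1\<^sub>m n) = 1\<^sub>m n"
proof -
  show "adj (1\<^sub>m n) = 1\<^sub>m n" by (rule eq_matI) auto
  then show "unitary (1\<^sub>m n)" by (intro unitaryI[of _ n]) auto
qed

lemma mat_fun_rdiag: "mat_fun f (rdiag n lam) = rdiag n (f \<circ> lam)"
  using mat_fun_diag[of "1\<^sub>m n" n "rdiag n lam" lam f] by simp

lemma cinner_diag_conj:
  assumes U: "U \<in> carrier_mat m n" and v: "v \<in> carrier_vec m"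
  shows "cinner v ((U * rdiag n lam * adj U) *\<^sub>v v) = complex_of_real (\<Sum>k<n. lam k * (cmod ((adj U *\<^sub>v v) $ k))\<^sup>2)"
proof -
  define w where "w = adj U *\<^sub>v v"
  have w: "w \<in> carrier_vec n" using U by (intro carrier_vecI) (simp add: w_def)
  have "(U * rdiag n lam * adj U) *\<^sub>v v = U *\<^sub>v (rdiag n lam *\<^sub>v w)"
    using U v by (simp add: w_def assoc_mult_mat_vec_dim)
  then have "cinner v ((U * rdiag n lam * adj U) *\<^sub>v v) = cinner w (rdiag n lam *\<^sub>v w)"
    using cinner_adj[OF U v mult_mat_vec_carrier[OF rdiag_carrier(1) w]] by (simp add: w_def)
  also have "\<dots> = (\<Sum>i<n. \<Sum>j<n. cnj (w $ i) * rdiag n lam $$ (i,j) * w $ j)"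
    using w by (intro cinner_mult_mat) auto
  also have "\<dots> = (\<Sum>i<n. complex_of_real (lam i * (cmod (w $ i))\<^sup>2))"
  proof (intro sum.cong refl)
    fix i assume i: "i \<in> {..<n}"
    have "(\<Sum>j<n. cnj (w $ i) * rdiag n lam $$ (i,j) * w $ j) = (\<Sum>j<n. if j = i then complex_of_real (lam i) * (w $ i * cnj (w $ i)) else 0)"
      using i by (intro sum.cong) auto
    then show "(\<Sum>j<n. cnj (w $ i) * rdiag n lam $$ (i,j) * w $ j) = complex_of_real (lam i * (cmod (w $ i))\<^sup>2)"
      using i by (simp add: complex_norm_square[symmetric])
  qed
  finally show ?thesis by (simp add: w_def)
qed

lemma spd_diag_conj:
  assumes U: "unitary U" "dim_row U = n" and pos: "\<And>i. i < n \<Longrightarrow> 0 < lam i"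
  shows "spd (U * rdiag n lam * adj U)"
proof -
  note u = unitaryD[OF U]
  have "psd (U * rdiag n lam * adj U)" using pos by (intro psd_diag_conj[OF u(1)]) (auto intro: less_imp_le)
  moreover have "0 < Re (cinner v ((U * rdiag n lam * adj U) *\<^sub>v v))"
    if v: "v \<in> carrier_vec n" "v \<noteq> 0\<^sub>v n" for v
  proof -
    define w where "w = adj U *\<^sub>v v"
    have "U *\<^sub>v w = v"
      using u v by (simp add: w_def assoc_mult_mat_vec_dim[symmetric])
    moreover have "U *\<^sub>v 0\<^sub>v n = 0\<^sub>v n" using u(1) by (intro eq_vecI) auto
    ultimately have "w \<noteq> 0\<^sub>v n" using v by auto
    then obtain k where k: "k < n" "w $ k \<noteq> 0" using u v by (auto simp: vec_eq_iff w_def)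
    have "0 < (\<Sum>k<n. lam k * (cmod (w $ k))\<^sup>2)"
      by (rule sum_pos2[of _ k]) (use k pos in \<open>auto intro!: mult_nonneg_nonneg simp: less_imp_le\<close>)
    then show ?thesis using cinner_diag_conj[OF u(1) v(1), of lam] by (simp add: w_def)
  qed
  ultimately show ?thesis using u(1) by (auto simp: spd_def psd_def)
qed

section \<open>Operator monotone functions lie below their tangents\<close>

text \<open>With a unit vector of weights \<open>1 - t\<close>, \<open>t\<close> one has \<open>A = U diag(1,x) U*\<close> with upper left entry
  \<open>1 + t (x - 1)\<close>. Adding \<open>t\<^sup>2\<close> to that entry leaves room to dominate \<open>A\<close> by a diagonal matrix, and the
  slack \<open>t\<^sup>2\<close> vanishes to first order, so that no continuity of \<open>P\<close> is needed.\<close>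

lemma operator_monotone_chord_le:
  assumes P: "operator_monotone P" and x: "0 < x" and t: "0 < t" "t < 1"
  shows "(1 - t) * P 1 + t * P x \<le> P (1 + t * (x - 1) + t\<^sup>2)"
proof -
  define c where "c = sqrt (1 - t)"
  define s where "s = sqrt t"
  have cs: "c * c = 1 - t" "s * s = t" using t by (auto simp: c_def s_def)
  define lam where "lam = (\<lambda>k::nat. if k = 0 then 1 else x)"
  define U where "U = mat 2 2 (\<lambda>(i,j). complex_of_real (if i = 0 then (if j = 0 then c else - s) else (if j = 0 then s else c)))"
  have U: "U \<in> carrier_mat 2 2" "dim_row U = 2" by (auto simp: U_def)
  have less2: "i < 2 \<longleftrightarrow> i = 0 \<or> i = (1::nat)" for i by auto
  have UU: "unitary U"
  proof (rule unitaryI[OF U(1)], rule eq_matI)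
    fix i j assume "i < dim_row (1\<^sub>m 2)" "j < dim_col (1\<^sub>m 2)"
    then have ij: "i < 2" "j < 2" by auto
    have "(adj U * U) $$ (i,j) = (\<Sum>l<2. adj U $$ (i,l) * U $$ (l,j))"
      using U ij by (intro index_mult_mat_sum) auto
    then show "(adj U * U) $$ (i,j) = 1\<^sub>m 2 $$ (i,j)"
      using ij cs by (auto simp: less2 U_def lessThan_Suc numeral_2_eq_2 simp flip: of_real_mult of_real_add)
  qed (use U in auto)
  define A where "A = U * rdiag 2 lam * adj U"
  define k where "k = c * s * (1 - x)"
  define m where "m = 1 + t * (x - 1)"
  \<comment> \<open>\<open>rdiag 2 mu - A\<close> has diagonal entries \<open>t\<^sup>2\<close> and
    \<open>(k / t)\<^sup>2\<close> and off-diagonal entries \<open>- k\<close>, which is the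
    rank-one matrix built from the row \<open>C\<close>. The lower entry of \<open>mu\<close> may
    blow up as \<open>t\<close> tends to 0; only the upper left entry is read off in the
    end.\<close>
  define mu where "mu = (\<lambda>i::nat. if i = 0 then m + t\<^sup>2 else s * s + c * c * x + (k / t)\<^sup>2)"
  define C where "C = mat 1 2 (\<lambda>(i,j). complex_of_real (if j = 0 then t else - k / t))"
  have A: "A \<in> carrier_mat 2 2" using U by (auto simp: A_def)
  have Aent: "A $$ (i,j) = complex_of_real (if i = 0 then (if j = 0 then m else k) else (if j = 0 then k else s * s + c * c * x))"
    if ij: "i < 2" "j < 2" for i j
  proof -
    have "c * c + x * (s * s) = m" unfolding cs m_def by (simp add: algebra_simps)
    then have m: "complex_of_real c * complex_of_real c + complex_of_real x * (complex_of_real s * complex_of_real s) = complex_of_real m"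
      by (metis of_real_add of_real_mult)
    have "A $$ (i,j) = (\<Sum>l<2. complex_of_real (lam l) * U $$ (i,l) * cnj (U $$ (j,l)))"
      unfolding A_def by (rule index_diag_conj[OF U(1) ij])
    then show ?thesis using ij m
      by (auto simp: less2 U_def lam_def k_def lessThan_Suc numeral_2_eq_2 algebra_simps)
  qed
  have C: "C \<in> carrier_mat 1 2" by (simp add: C_def)
  have "rdiag 2 mu - A = adj C * rdiag 1 (\<lambda>_. 1) * C"
  proof (rule eq_matI)
    fix i j assume "i < dim_row (adj C * rdiag 1 (\<lambda>_. 1) * C)" "j < dim_col (adj C * rdiag 1 (\<lambda>_. 1) * C)"
    then have ij: "i < 2" "j < 2" using C by auto
    have "(adj C * rdiag 1 (\<lambda>_. 1) * adj (adj C)) $$ (i,j) = (\<Sum>l<1. complex_of_real 1 * adj C $$ (i,l) * cnj (adj C $$ (j,l)))"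
      by (rule index_diag_conj) (use C ij in auto)
    then have "(adj C * rdiag 1 (\<lambda>_. 1) * C) $$ (i,j) = cnj (C $$ (0,i)) * C $$ (0,j)"
      using C ij by simp
    moreover have "(rdiag 2 mu - A) $$ (i,j) = rdiag 2 mu $$ (i,j) - A $$ (i,j)"
      using A ij by simp
    moreover have "rdiag 2 mu $$ (i,j) - A $$ (i,j) = cnj (C $$ (0,i)) * C $$ (0,j)"
      unfolding Aent[OF ij] using ij t by (auto simp: less2 C_def mu_def power2_eq_square)
    ultimately show "(rdiag 2 mu - A) $$ (i,j) = (adj C * rdiag 1 (\<lambda>_. 1) * C) $$ (i,j)" by (simp only:)
  qed (use A C in auto)
  moreover have "psd (adj C * rdiag 1 (\<lambda>_. 1) * C)"
    by (rule psd_congruence[OF _ psd_rdiag C]) auto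
  ultimately have "psd (rdiag 2 mu - A)" by simp
  moreover have "spd A" unfolding A_def by (rule spd_diag_conj[OF UU U(2)]) (use x in \<open>auto simp: lam_def\<close>)
  moreover have "spd (rdiag 2 mu)"
  proof -
    have "m > 0"
    proof -
      have "m = (1 - t) + t * x" by (simp add: m_def algebra_simps)
      then show ?thesis using t x by (auto intro!: add_pos_pos)
    qed
    then have "0 < mu i" for i
      using t x unfolding mu_def cs by (auto intro!: add_pos_nonneg)
    then show ?thesis using spd_diag_conj[of "1\<^sub>m 2" 2 mu] by simp
  qed
  ultimately have psd: "psd (mat_fun P (rdiag 2 mu) - mat_fun P A)"
    using P A unfolding operator_monotone_def by (metis rdiag_carrier(1))
  have fA: "mat_fun P A = U * rdiag 2 (P \<circ> lam) * adj U" by (rule mat_fun_diag[OF UU U(2) A_def])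
  \<comment> \<open>The first row of \<open>U\<close> has squared moduli \<open>1 - t\<close> and
    \<open>t\<close>, so this entry is the convex combination of \<open>P 1\<close> and
    \<open>P x\<close>.\<close>
  have "mat_fun P A $$ (0,0) = (\<Sum>l<2. complex_of_real ((P \<circ> lam) l) * U $$ (0,l) * cnj (U $$ (0,l)))"
    unfolding fA by (rule index_diag_conj[OF U(1)]) auto
  also have "\<dots> = complex_of_real ((c * c) * P 1 + (s * s) * P x)"
    by (simp add: U_def lam_def lessThan_Suc numeral_2_eq_2)
  finally have "mat_fun P A $$ (0,0) = complex_of_real ((1 - t) * P 1 + t * P x)" unfolding cs .
  moreover have "0 \<le> Re ((mat_fun P (rdiag 2 mu) - mat_fun P A) $$ (0,0))"
    by (rule psd_diag_nonneg[OF _ psd]) (use U fA in auto)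
  moreover have "dim_row (mat_fun P A) = 2" "dim_col (mat_fun P A) = 2" using U fA by auto
  ultimately show ?thesis by (simp add: mat_fun_rdiag mu_def m_def)
qed

text \<open>The chord inequality says that \<open>f\<close> does not fall below
  \<open>f 0 = P 1\<close> on \<open>(0,1)\<close>. If \<open>P x\<close> exceeded the tangent,
  \<open>f\<close> would have negative slope at 0; the term \<open>t\<^sup>2\<close> does not
  contribute to that slope.\<close>

lemma operator_monotone_le_tangent:
  assumes P: "operator_monotone P" "(P has_real_derivative D) (at 1)" and x: "0 < x"
  shows "P x \<le> P 1 + D * (x - 1)"
proof (rule ccontr)
  assume contra: "\<not> ?thesis"
  define f where "f t = P (1 + t * (x - 1) + t\<^sup>2) - t * (P x - P 1)" for t
  have "((\<lambda>t. P (1 + t * (x - 1) + t\<^sup>2)) has_real_derivative D * (x - 1)) (at 0)"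
    by (rule DERIV_chain2[where g = "\<lambda>t. 1 + t * (x - 1) + t\<^sup>2"])
       (use P(2) in \<open>auto intro!: derivative_eq_intros\<close>)
  then have "(f has_real_derivative D * (x - 1) - (P x - P 1)) (at 0)"
    unfolding f_def by (auto intro!: derivative_eq_intros)
  moreover have "D * (x - 1) - (P x - P 1) < 0" using contra by simp
  ultimately obtain d where d: "d > 0" "\<And>h. 0 < h \<Longrightarrow> h < d \<Longrightarrow> f (0 + h) < f 0"
    using DERIV_neg_dec_right by blast
  define h where "h = min (d / 2) (1 / 2)"
  have h: "0 < h" "h < d" "h < 1" using d by (auto simp: h_def)
  have "f h < P 1" using d(2)[of h] h by (simp add: f_def)
  moreover have "P 1 \<le> f h"
    using operator_monotone_chord_le[OF P(1) x h(1,3)] by (simp add: f_def algebra_simps)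
  ultimately show False by simp
qed

section \<open>Inverses and Gram matrices\<close>

lemma minv_inverse:
  fixes A :: "'a::field mat"
  assumes A: "A \<in> carrier_mat n n" and inv: "invertible_mat A"
  shows "minv A \<in> carrier_mat n n" "A * minv A = 1\<^sub>m n" "minv A * A = 1\<^sub>m n"
proof -
  obtain B where B: "A * B = 1\<^sub>m n" "B * A = 1\<^sub>m (dim_row B)"
    using inv A by (auto simp: invertible_mat_def inverts_mat_def)
  have Bc: "B \<in> carrier_mat n n"
    using arg_cong[OF B(1), of dim_col] arg_cong[OF B(2), of dim_col] A by auto
  have "A \<in> Units (ring_mat TYPE('a) n ())"
    using A B Bc by (auto simp: Units_def ring_mat_simps)
  then obtain C where "mat_inverse A = Some C"
    using mat_inverse(1)[OF A, where b = "()"] by (cases "mat_inverse A") auto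
  then show "minv A \<in> carrier_mat n n" "A * minv A = 1\<^sub>m n" "minv A * A = 1\<^sub>m n"
    using mat_inverse(2)[OF A] by (auto simp: minv_def)
qed

lemma hermitian_inverse:
  assumes A: "A \<in> carrier_mat n n" "hermitian A" and B: "B \<in> carrier_mat n n" "A * B = 1\<^sub>m n"
  shows "hermitian B"
proof -
  have "adj B * A = 1\<^sub>m n"
    using adj_mult[OF A(1) B(1)] A(2) B(2) by (simp add: hermitianD)
  then have "adj B * A * B = B" using B by simp
  moreover have "adj B * A * B = adj B" using A(1) B by (simp add: assoc_mult_mat_dim)
  ultimately show ?thesis using B by (auto simp: hermitian_def)
qed

lemma psd_inverse_diff:
  assumes A: "A \<in> carrier_mat n n" "hermitian A" and B: "B \<in> carrier_mat n n" "psd B"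
    and AB: "psd (A - B)"
    and A': "A' \<in> carrier_mat n n" "A * A' = 1\<^sub>m n" and B': "B' \<in> carrier_mat n n" "B * B' = 1\<^sub>m n"
  shows "psd (B' - A')"
proof -
  have hA: "adj A' = A'" and hB: "adj B' = B'"
    using hermitian_inverse[OF A A'] hermitian_inverse[OF B(1) psd_imp_hermitian[OF B(2)] B'] by (auto dest: hermitianD)
  have A'A: "A' * A = 1\<^sub>m n" and B'B: "B' * B = 1\<^sub>m n"
    using mat_mult_left_right_inverse A A' B B' by blast+
  \<comment> \<open>\<open>B' - A' = (B' - A') B (B' - A') + A' (A - B) A'\<close>\<close>
  define D where "D = B' - A'"
  have D: "D \<in> carrier_mat n n" using A' by (auto simp: D_def)
  have hD: "adj D = D"
  proof -
    have "adj D = adj B' - adj A'" unfolding D_def by (rule eq_matI) (use A' B' in auto)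
    then show ?thesis by (simp add: D_def hA hB)
  qed
  have DBD: "D * B * D = (B' - A') - (A' - A' * B * A')"
  proof -
    have AB': "A' * B \<in> carrier_mat n n" "A' * B * A' \<in> carrier_mat n n" using A' B by auto
    have "D * B = 1\<^sub>m n - A' * B" unfolding D_def using minus_mult_distrib_mat[OF B'(1) A'(1) B(1)] B'B by simp
    then have "D * B * D = D - A' * B * D"
      using minus_mult_distrib_mat[OF one_carrier_mat AB'(1) D] D by simp
    also have "A' * B * D = A' * B * B' - A' * B * A'"
      unfolding D_def by (rule mult_minus_distrib_mat[OF AB'(1) B'(1) A'(1)])
    also have "A' * B * B' = A'" using A' B(1) B' by (simp add: assoc_mult_mat_dim)
    finally show ?thesis by (simp add: D_def)
  qed
  have AAB: "A' * (A - B) * A' = A' - A' * B * A'"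
    using sandwich_linear(2)[OF A'(1) A(1) B(1) A'(1)] A'A A' by simp
  have "psd (adj D * B * D + adj A' * (A - B) * A')"
    by (rule psd_add[of _ n])
       (use psd_congruence[OF B D] psd_congruence[OF _ AB A'(1)] A A' B D in \<open>auto simp: minus_carrier_mat\<close>)
  moreover have "adj D * B * D + adj A' * (A - B) * A' = D"
    unfolding hD hA DBD AAB unfolding D_def by (rule eq_matI) (use A' B B' in \<open>auto simp del: index_mult_mat(1)\<close>)
  ultimately show ?thesis by (simp add: D_def)
qed

section \<open>Quadratic forms of Gram matrices and Cauchy-Schwarz inequalities\<close>

lemma gram_quadratic_form:
  fixes v :: "nat \<Rightarrow> complex" and w :: "'k \<Rightarrow> real"
  shows "(\<Sum>i<d. \<Sum>j<d. cnj (v i) * (\<Sum>k\<in>K. cnj (e i k) * e j k / complex_of_real (w k)) * v j) =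
     complex_of_real (\<Sum>k\<in>K. (cmod (\<Sum>i<d. v i * e i k))\<^sup>2 / w k)"
proof -
  have "(\<Sum>i<d. \<Sum>j<d. cnj (v i) * (\<Sum>k\<in>K. cnj (e i k) * e j k / complex_of_real (w k)) * v j)
     = (\<Sum>i<d. \<Sum>j<d. \<Sum>k\<in>K. cnj (v i * e i k) * (v j * e j k) / complex_of_real (w k))"
    by (simp add: sum_distrib_left sum_distrib_right mult_ac)
  also have "\<dots> = (\<Sum>k\<in>K. \<Sum>i<d. \<Sum>j<d. cnj (v i * e i k) * (v j * e j k) / complex_of_real (w k))"
    by (simp only: sum.swap[of _ K])
  also have "\<dots> = (\<Sum>k\<in>K. (cnj (\<Sum>i<d. v i * e i k) * (\<Sum>j<d. v j * e j k)) / complex_of_real (w k))"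
    unfolding cnj_sum sum_product sum_divide_distrib ..
  also have "\<dots> = (\<Sum>k\<in>K. complex_of_real ((cmod (\<Sum>i<d. v i * e i k))\<^sup>2 / w k))"
    by (intro sum.cong refl) (simp only: of_real_divide complex_norm_square mult.commute)
  finally show ?thesis by simp
qed

text \<open>For \<open>c > 0\<close> the minimizer \<open>z = b / c\<close> gives the claim. The
  case \<open>c = 0\<close> matters because an outcome may have probability 0; there the expression
  is affine along multiples of \<open>b\<close> and forces \<open>b = 0\<close>.\<close>

lemma cauchy_schwarz_from_quadratic:
  fixes b :: complex
  assumes q: "\<And>z. 0 \<le> a - 2 * Re (cnj z * b) + (cmod z)\<^sup>2 * c" and c: "0 \<le> c"
  shows "(cmod b)\<^sup>2 \<le> c * a"
proof (cases "c = 0")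
  case True
  have "b = 0"
  proof (rule ccontr)
    assume b: "b \<noteq> 0"
    \<comment> \<open>Scaled so that the linear term equals \<open>a + 1\<close> and the expression
      drops to \<open>- 1\<close>.\<close>
    define r where "r = (a + 1) / (2 * (cmod b)\<^sup>2)"
    have "Re (cnj (complex_of_real r * b) * b) = r * (cmod b)\<^sup>2"
      by (simp add: cmod_power2) (simp add: power2_eq_square algebra_simps)
    then have "0 \<le> a - 2 * (r * (cmod b)\<^sup>2)" using q[of "complex_of_real r * b"] True by simp
    moreover have "2 * (r * (cmod b)\<^sup>2) = a + 1" using b by (simp add: r_def)
    ultimately show False by simp
  qed
  then show ?thesis using True by simp
next
  case False
  then have c: "c > 0" using c by simp
  have "Re (cnj (b / complex_of_real c) * b) = (cmod b)\<^sup>2 / c"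
    by (simp add: cmod_power2) (simp add: power2_eq_square add_divide_distrib)
  moreover have "(cmod (b / complex_of_real c))\<^sup>2 * c = (cmod b)\<^sup>2 / c"
    using c by (simp add: norm_divide power2_eq_square)
  ultimately have "0 \<le> a - (cmod b)\<^sup>2 / c" using q[of "b / complex_of_real c"] by linarith
  then show ?thesis using c by (simp add: field_simps)
qed

lemma psd_form_nonneg:
  assumes m: "m \<in> carrier_mat n n" "psd m"
  shows "0 \<le> Re (\<Sum>a<n. \<Sum>c<n. cnj (f a) * m $$ (a,c) * f c)"
proof -
  have "0 \<le> Re (\<Sum>a<n. \<Sum>c<n. cnj (vec n f $ a) * m $$ (a,c) * vec n f $ c)"
    using m psd_iff[of m n] vec_carrier by blast
  also have "(\<Sum>a<n. \<Sum>c<n. cnj (vec n f $ a) * m $$ (a,c) * vec n f $ c) =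
      (\<Sum>a<n. \<Sum>c<n. cnj (f a) * m $$ (a,c) * f c)" by simp
  finally show ?thesis .
qed

text \<open>Cauchy-Schwarz for the positive form on families of vectors given by the
  \<open>lam\<close>-weighted sum over \<open>k\<close> of the form \<open>m\<close>, applied to the
  standard basis \<open>e k\<close> and the family \<open>v k\<close>. For \<open>lam\<close> the
  spectrum of a state and \<open>m\<close> a measurement effect, the first factor is the outcome
  probability.\<close>

lemma psd_weighted_cauchy_schwarz:
  assumes m: "m \<in> carrier_mat n n" "psd m" and lam: "\<And>k. k < n \<Longrightarrow> 0 \<le> lam k"
  shows "(cmod (\<Sum>k<n. \<Sum>c<n. complex_of_real (lam k) * (m $$ (k,c) * v k c)))\<^sup>2 \<le>
     (\<Sum>k<n. lam k * Re (m $$ (k,k))) *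
     Re (\<Sum>k<n. complex_of_real (lam k) * (\<Sum>a<n. \<Sum>c<n. cnj (v k a) * m $$ (a,c) * v k c))"
    (is "(cmod ?b)\<^sup>2 \<le> ?c * ?a")
proof (rule cauchy_schwarz_from_quadratic)
  show "0 \<le> ?c" using lam psd_diag_nonneg[OF m] by (auto intro!: sum_nonneg)
  fix z :: complex
  define F where "F f g = (\<Sum>a<n. \<Sum>c<n. cnj (f a) * m $$ (a,c) * g c)" for f g
  define e where "e k a = (if a = k then 1 else 0 :: complex)" for k a :: nat
  have pos: "0 \<le> Re (F f f)" for f
    unfolding F_def by (rule psd_form_nonneg[OF m])
  have herm: "F g f = cnj (F f g)" for f g
  proof -
    have "cnj (F f g) = (\<Sum>a<n. \<Sum>c<n. cnj (g c) * m $$ (c,a) * f a)"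
      unfolding F_def cnj_sum using m(2) hermitian_iff[OF m(1)]
      by (intro sum.cong refl) (auto simp: psd_def mult_ac)
    then show ?thesis unfolding F_def by (subst sum.swap) simp
  qed
  have expand: "F (\<lambda>a. f a - z * g a) (\<lambda>a. f a - z * g a) = F f f - cnj z * F g f - z * F f g + (z * cnj z) * F g g" for f g
    unfolding F_def sum_distrib_left sum_subtractf[symmetric] sum.distrib[symmetric]
    by (intro sum.cong refl) (simp add: ring_distribs mult_ac)
  have Re_expand: "Re (F (\<lambda>a. f a - z * g a) (\<lambda>a. f a - z * g a)) =
      Re (F f f) - 2 * Re (cnj z * F g f) + (cmod z)\<^sup>2 * Re (F g g)" for f g
    unfolding expand herm[of f g] complex_norm_square[symmetric] by simp
  have Fee: "F (e k) (e k) = m $$ (k,k)" and Fev: "F (e k) g = (\<Sum>c<n. m $$ (k,c) * g c)" if k: "k < n" for k g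
  proof -
    have "F (e k) g = (\<Sum>a<n. if a = k then (\<Sum>c<n. m $$ (k,c) * g c) else 0)" for g
      unfolding F_def e_def by (intro sum.cong refl) auto
    then show *: "F (e k) g = (\<Sum>c<n. m $$ (k,c) * g c)" for g using k by simp
    have "F (e k) (e k) = (\<Sum>c<n. if c = k then m $$ (k,k) else 0)"
      unfolding * e_def by (intro sum.cong) auto
    then show "F (e k) (e k) = m $$ (k,k)" using k by simp
  qed
  have "0 \<le> (\<Sum>k<n. lam k * Re (F (\<lambda>a. v k a - z * e k a) (\<lambda>a. v k a - z * e k a)))"
    using lam pos by (auto intro!: sum_nonneg)
  also have "\<dots> = (\<Sum>k<n. lam k * Re (F (v k) (v k))) - 2 * (\<Sum>k<n. lam k * Re (cnj z * F (e k) (v k)))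
      + (cmod z)\<^sup>2 * (\<Sum>k<n. lam k * Re (F (e k) (e k)))"
    unfolding Re_expand sum_distrib_left sum_subtractf[symmetric] sum.distrib[symmetric]
    by (intro sum.cong refl) (simp only: ring_distribs mult_ac)
  also have "(\<Sum>k<n. lam k * Re (F (v k) (v k))) = ?a" by (simp add: F_def)
  also have "(\<Sum>k<n. lam k * Re (cnj z * F (e k) (v k))) = Re (cnj z * ?b)"
  proof -
    have "cnj z * ?b = (\<Sum>k<n. complex_of_real (lam k) * (cnj z * F (e k) (v k)))"
      by (simp add: Fev sum_distrib_left mult_ac)
    then show ?thesis by simp
  qed
  also have "(\<Sum>k<n. lam k * Re (F (e k) (e k))) = ?c" by (simp add: Fee)
  finally show "0 \<le> ?a - 2 * Re (cnj z * ?b) + (cmod z)\<^sup>2 * ?c" .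
qed

lemma sum_form_resolution:
  assumes one: "\<And>a c. a < n \<Longrightarrow> c < n \<Longrightarrow> (\<Sum>x\<in>X. M x $$ (a,c)) = (if a = c then 1 else 0)"
  shows "(\<Sum>x\<in>X. \<Sum>a<n. \<Sum>c<n. cnj (f a) * M x $$ (a,c) * f c) = complex_of_real (\<Sum>a<n. (cmod (f a))\<^sup>2)"
proof -
  have "(\<Sum>x\<in>X. \<Sum>a<n. \<Sum>c<n. cnj (f a) * M x $$ (a,c) * f c)
     = (\<Sum>a<n. \<Sum>c<n. \<Sum>x\<in>X. cnj (f a) * M x $$ (a,c) * f c)"
    by (simp only: sum.swap[of _ X])
  also have "\<dots> = (\<Sum>a<n. \<Sum>c<n. cnj (f a) * (\<Sum>x\<in>X. M x $$ (a,c)) * f c)"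
    by (simp only: sum_distrib_left sum_distrib_right)
  also have "\<dots> = (\<Sum>a<n. \<Sum>c<n. if c = a then cnj (f a) * f a else 0)"
    by (intro sum.cong refl) (simp add: one)
  also have "\<dots> = (\<Sum>a<n. complex_of_real ((cmod (f a))\<^sup>2))"
    unfolding complex_norm_square by (simp add: mult.commute)
  finally show ?thesis by simp
qed

text \<open>Here \<open>Y\<close> is a complex combination of the derivatives of the state, written in its eigenbasis. Two
  Cauchy-Schwarz estimates, one for left and one for right multiplication by the state, are
  combined by convexity.\<close>

lemma measured_fisher_le:
  fixes Y :: "nat \<Rightarrow> nat \<Rightarrow> complex"
  assumes X: "finite X" and lam: "\<And>a. a < n \<Longrightarrow> 0 < lam a" and \<beta>: "-1 \<le> \<beta>" "\<beta> \<le> 1"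
    and M: "\<And>x. x \<in> X \<Longrightarrow> M x \<in> carrier_mat n n \<and> psd (M x)"
    and one: "\<And>a c. a < n \<Longrightarrow> c < n \<Longrightarrow> (\<Sum>x\<in>X. M x $$ (a,c)) = (if a = c then 1 else 0)"
  shows "(\<Sum>x\<in>X. (cmod (\<Sum>a<n. \<Sum>b<n. Y a b * M x $$ (b,a)))\<^sup>2 / (\<Sum>a<n. lam a * Re (M x $$ (a,a))))
    \<le> (\<Sum>a<n. \<Sum>b<n. (cmod (Y a b))\<^sup>2 / (lam b * P_beta \<beta> (lam a / lam b)))"
proof -
  define g h where "g = (1 + \<beta>) / 2" and "h = (1 - \<beta>) / 2"
  have gh: "0 \<le> g" "0 \<le> h" "g + h = 1" using \<beta> by (auto simp: g_def h_def field_simps)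
  define w where "w a b = g * lam a + h * lam b" for a b
  have w: "lam b * P_beta \<beta> (lam a / lam b) = w a b" if "a < n" "b < n" for a b
    using lam[OF that(2)] by (simp add: P_beta_def w_def g_def h_def field_simps)
  have wpos: "0 < w a b" if "a < n" "b < n" for a b
  proof -
    have "0 < g \<or> 0 < h" using gh by linarith
    then show ?thesis unfolding w_def using gh lam[OF that(1)] lam[OF that(2)]
      by (auto intro: add_pos_nonneg add_nonneg_pos simp: less_imp_le)
  qed
  \<comment> \<open>The logarithmic derivative in the eigenbasis: \<open>Y\<close> is
    \<open>g\<close> times state times \<open>L\<close> plus \<open>h\<close> times \<open>L\<close>
    times state, solved entrywise.\<close>
  define L where "L a b = Y a b / complex_of_real (w a b)" for a b
  have Y: "Y a b = complex_of_real (w a b) * L a b" if "a < n" "b < n" for a b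
    using wpos[OF that] by (simp add: L_def)
  define p where "p x = (\<Sum>a<n. lam a * Re (M x $$ (a,a)))" for x
  define S where "S x = (\<Sum>a<n. \<Sum>b<n. Y a b * M x $$ (b,a))" for x
  \<comment> \<open>With the state \<open>diag lam\<close>, \<open>cnj (r x)\<close> is the trace of
    state, \<open>L\<close>, \<open>M x\<close> in this order, and \<open>s x\<close> that of
    \<open>L\<close>, state, \<open>M x\<close>. The conjugate puts \<open>r\<close> into the shape
    of the weighted Cauchy-Schwarz inequality.\<close>
  define r where "r x = (\<Sum>k<n. \<Sum>c<n. complex_of_real (lam k) * (M x $$ (k,c) * cnj (L k c)))" for x
  define s where "s x = (\<Sum>k<n. \<Sum>c<n. complex_of_real (lam k) * (M x $$ (k,c) * L c k))" for x
  define F where "F x f = (\<Sum>a<n. \<Sum>c<n. cnj (f a) * M x $$ (a,c) * f c)" for x and f :: "nat \<Rightarrow> complex"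
  define q1 where "q1 x = Re (\<Sum>k<n. complex_of_real (lam k) * F x (\<lambda>c. cnj (L k c)))" for x
  define q2 where "q2 x = Re (\<Sum>k<n. complex_of_real (lam k) * F x (\<lambda>c. L c k))" for x
  have step: "(cmod (S x))\<^sup>2 / p x \<le> g * q1 x + h * q2 x" if x: "x \<in> X" for x
  proof -
    note m = M[OF x, THEN conjunct1] M[OF x, THEN conjunct2]
    have lam0: "0 \<le> lam a" if "a < n" for a using lam[OF that] by simp
    have p0: "0 \<le> p x" unfolding p_def using lam0 psd_diag_nonneg[OF m] by (auto intro!: sum_nonneg)
    have F0: "0 \<le> Re (F x f)" for f unfolding F_def by (rule psd_form_nonneg[OF m])
    have q0: "0 \<le> q1 x" "0 \<le> q2 x" unfolding q1_def q2_def using lam0 F0 by (auto intro!: sum_nonneg)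
    have r2: "(cmod (r x))\<^sup>2 \<le> p x * q1 x"
      unfolding r_def p_def q1_def F_def by (rule psd_weighted_cauchy_schwarz[OF m lam0])
    have s2: "(cmod (s x))\<^sup>2 \<le> p x * q2 x"
      unfolding s_def p_def q2_def F_def by (rule psd_weighted_cauchy_schwarz[OF m lam0])
    have "cnj (r x) = (\<Sum>a<n. \<Sum>b<n. complex_of_real (lam a) * (M x $$ (b,a) * L a b))"
      unfolding r_def cnj_sum using m(2) hermitian_iff[OF m(1)]
      by (intro sum.cong refl) (auto simp: psd_def)
    moreover have "s x = (\<Sum>a<n. \<Sum>b<n. complex_of_real (lam b) * (M x $$ (b,a) * L a b))"
      unfolding s_def by (rule sum.swap)
    ultimately have "complex_of_real g * cnj (r x) + complex_of_real h * s x = (\<Sum>a<n. \<Sum>b<n.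
        complex_of_real g * (complex_of_real (lam a) * (M x $$ (b,a) * L a b)) +
        complex_of_real h * (complex_of_real (lam b) * (M x $$ (b,a) * L a b)))"
      by (simp only: sum_distrib_left sum.distrib)
    also have "\<dots> = S x" unfolding S_def
      by (intro sum.cong refl) (simp add: Y w_def ring_distribs mult_ac)
    finally have S: "S x = complex_of_real g * cnj (r x) + complex_of_real h * s x" ..
    have "cmod (S x) \<le> g * cmod (r x) + h * cmod (s x)"
      unfolding S by (rule order_trans[OF norm_triangle_ineq]) (use gh in \<open>simp add: norm_mult\<close>)
    then have "(cmod (S x))\<^sup>2 \<le> (g * cmod (r x) + h * cmod (s x))\<^sup>2"
      by (intro power_mono) auto
    also have "\<dots> \<le> g * (cmod (r x))\<^sup>2 + h * (cmod (s x))\<^sup>2"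
    proof -
      have h: "h = 1 - g" using gh by simp
      have "g * (cmod (r x))\<^sup>2 + h * (cmod (s x))\<^sup>2 - (g * cmod (r x) + h * cmod (s x))\<^sup>2 = g * h * (cmod (r x) - cmod (s x))\<^sup>2"
        unfolding h by (simp add: power2_eq_square algebra_simps)
      moreover have "0 \<le> g * h * (cmod (r x) - cmod (s x))\<^sup>2" using gh by simp
      ultimately show ?thesis by linarith
    qed
    also have "\<dots> \<le> g * (p x * q1 x) + h * (p x * q2 x)"
      using r2 s2 gh by (intro add_mono mult_left_mono) auto
    also have "\<dots> = p x * (g * q1 x + h * q2 x)" by (simp add: algebra_simps)
    finally have "(cmod (S x))\<^sup>2 \<le> p x * (g * q1 x + h * q2 x)" .
    \<comment> \<open>For \<open>p x = 0\<close> the quotient is 0 by convention and the right side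
      is nonnegative.\<close>
    then show ?thesis using p0 q0 gh by (cases "p x = 0") (auto simp: field_simps)
  qed
  have sumF: "(\<Sum>x\<in>X. F x f) = complex_of_real (\<Sum>a<n. (cmod (f a))\<^sup>2)" for f
    unfolding F_def by (rule sum_form_resolution[OF one])
  have Q: "(\<Sum>x\<in>X. Re (\<Sum>k<n. complex_of_real (lam k) * F x (f k))) = (\<Sum>k<n. \<Sum>a<n. lam k * (cmod (f k a))\<^sup>2)" for f
  proof -
    have "(\<Sum>x\<in>X. Re (\<Sum>k<n. complex_of_real (lam k) * F x (f k))) = Re (\<Sum>k<n. complex_of_real (lam k) * (\<Sum>x\<in>X. F x (f k)))"
      unfolding sum_distrib_left by (subst sum.swap) (simp only: Re_sum)
    also have "\<dots> = (\<Sum>k<n. lam k * (\<Sum>a<n. (cmod (f k a))\<^sup>2))" unfolding sumF by simp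
    finally show ?thesis by (simp only: sum_distrib_left)
  qed
  have "(\<Sum>x\<in>X. (cmod (S x))\<^sup>2 / p x) \<le> (\<Sum>x\<in>X. g * q1 x + h * q2 x)" by (rule sum_mono[OF step])
  also have "\<dots> = g * (\<Sum>x\<in>X. q1 x) + h * (\<Sum>x\<in>X. q2 x)" by (simp add: sum.distrib sum_distrib_left)
  also have "(\<Sum>x\<in>X. q1 x) = (\<Sum>a<n. \<Sum>b<n. lam a * (cmod (L a b))\<^sup>2)" unfolding q1_def Q by simp
  also have "(\<Sum>x\<in>X. q2 x) = (\<Sum>a<n. \<Sum>b<n. lam b * (cmod (L a b))\<^sup>2)" unfolding q2_def Q by (rule sum.swap)
  \<comment> \<open>Summing over outcomes removes the measurement; the two weights recombine to the
    denominator \<open>w a b\<close> of the metric.\<close>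
  also have "g * (\<Sum>a<n. \<Sum>b<n. lam a * (cmod (L a b))\<^sup>2) + h * (\<Sum>a<n. \<Sum>b<n. lam b * (cmod (L a b))\<^sup>2)
     = (\<Sum>a<n. \<Sum>b<n. w a b * (cmod (L a b))\<^sup>2)"
    unfolding sum_distrib_left sum.distrib[symmetric] by (simp add: w_def ring_distribs mult_ac)
  also have "\<dots> = (\<Sum>a<n. \<Sum>b<n. (cmod (Y a b))\<^sup>2 / (lam b * P_beta \<beta> (lam a / lam b)))"
  proof (intro sum.cong refl)
    fix a b assume "a \<in> {..<n}" "b \<in> {..<n}"
    then have ab: "a < n" "b < n" by auto
    have "(cmod (L a b))\<^sup>2 = (cmod (Y a b))\<^sup>2 / (w a b)\<^sup>2"
      using wpos[OF ab] by (simp add: L_def norm_divide power_divide)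
    then show "w a b * (cmod (L a b))\<^sup>2 = (cmod (Y a b))\<^sup>2 / (lam b * P_beta \<beta> (lam a / lam b))"
      unfolding w[OF ab] using wpos[OF ab] by (simp add: power2_eq_square)
  qed
  finally show ?thesis unfolding S_def p_def .
qed

text \<open>The common shape of all Fisher matrices: the classical one is indexed by outcomes and
  weighted by their probabilities, a quantum one is indexed by pairs of eigenvectors of the state
  with weights \<open>lam b * P (lam a / lam b)\<close>.\<close>

definition gram :: "nat \<Rightarrow> 'k set \<Rightarrow> (nat \<Rightarrow> 'k \<Rightarrow> complex) \<Rightarrow> ('k \<Rightarrow> real) \<Rightarrow> complex mat" where
  "gram d K e w = mat d d (\<lambda>(i,j). \<Sum>k\<in>K. cnj (e i k) * e j k / complex_of_real (w k))"

lemma gram_carrier [simp]: "gram d K e w \<in> carrier_mat d d" "dim_row (gram d K e w) = d" "dim_col (gram d K e w) = d"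
  by (auto simp: gram_def)

lemma hermitian_gram: "hermitian (gram d K e w)"
  unfolding hermitian_iff[OF gram_carrier(1)] by (simp add: gram_def mult.commute)

text \<open>A Loewner comparison reduces to weighted sums of squares. The index sets may differ, so
  outcomes can be compared with pairs of eigenvectors.\<close>

lemma psd_gram_diff:
  assumes "\<And>v. (\<Sum>k\<in>K'. (cmod (\<Sum>i<d. v i * e' i k))\<^sup>2 / w' k) \<le> (\<Sum>k\<in>K. (cmod (\<Sum>i<d. v i * e i k))\<^sup>2 / w k)"
  shows "psd (gram d K e w - gram d K' e' w')"
proof -
  have car: "gram d K e w - gram d K' e' w' \<in> carrier_mat d d" by (rule minus_carrier_mat) simp
  have q: "(\<Sum>i<d. \<Sum>j<d. cnj (v $ i) * gram d K e w $$ (i,j) * v $ j)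
      = complex_of_real (\<Sum>k\<in>K. (cmod (\<Sum>i<d. v $ i * e i k))\<^sup>2 / w k)" for v K e and w :: "_ \<Rightarrow> real"
    unfolding gram_quadratic_form[symmetric] by (intro sum.cong refl) (simp add: gram_def)
  have "0 \<le> Re (\<Sum>i<d. \<Sum>j<d. cnj (v $ i) * (gram d K e w - gram d K' e' w') $$ (i,j) * v $ j)" for v
  proof -
    have "(\<Sum>i<d. \<Sum>j<d. cnj (v $ i) * (gram d K e w - gram d K' e' w') $$ (i,j) * v $ j) =
       (\<Sum>i<d. \<Sum>j<d. cnj (v $ i) * gram d K e w $$ (i,j) * v $ j) - (\<Sum>i<d. \<Sum>j<d. cnj (v $ i) * gram d K' e' w' $$ (i,j) * v $ j)"
      unfolding sum_subtractf[symmetric] by (intro sum.cong refl) (simp add: ring_distribs)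
    moreover have "(\<Sum>i<d. \<Sum>j<d. cnj (v $ i) * gram d K' e' w' $$ (i,j) * v $ j)
      = complex_of_real (\<Sum>k\<in>K'. (cmod (\<Sum>i<d. v $ i * e' i k))\<^sup>2 / w' k)"
      unfolding gram_quadratic_form[symmetric] by (intro sum.cong refl) (simp add: gram_def)
    ultimately show ?thesis unfolding q using assms[of "\<lambda>i. v $ i"] by simp
  qed
  moreover have "hermitian (gram d K e w - gram d K' e' w')"
    using hermitian_gram[of d K e w] hermitian_gram[of d K' e' w']
    unfolding hermitian_iff[OF car] hermitian_iff[OF gram_carrier(1)] by simp
  ultimately show ?thesis unfolding psd_iff[OF car] by blast
qed

lemma psd_gram:
  assumes "\<And>k. k \<in> K \<Longrightarrow> 0 \<le> w k"
  shows "psd (gram d K e w)"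
proof -
  have "psd (gram d K e w - gram d {} e w)"
    by (rule psd_gram_diff) (auto intro!: sum_nonneg divide_nonneg_nonneg assms)
  moreover have "gram d K e w - gram d {} e w = gram d K e w"
    by (rule eq_matI) (auto simp: gram_def)
  ultimately show ?thesis by simp
qed

section \<open>The Cramer-Rao inequality\<close>

text \<open>\<open>y\<close> is the error \<open>\<delta>\<close> minus its best linear prediction
  \<open>u / p\<close> from the score \<open>f / p\<close>. Its second moments under
  \<open>p\<close> form \<open>V - I\<close>, and pairing this Gram matrix with \<open>G\<close>
  gives a nonnegative number.\<close>

lemma classical_cramer_rao:
  fixes \<delta> f :: "nat \<Rightarrow> 'x \<Rightarrow> real" and p :: "'x \<Rightarrow> real"
  assumes X: "finite X" and p: "\<And>x. x \<in> X \<Longrightarrow> 0 \<le> p x"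
    and f0: "\<And>i x. i < d \<Longrightarrow> x \<in> X \<Longrightarrow> p x = 0 \<Longrightarrow> f i x = 0"
    and unb: "\<And>i j. i < d \<Longrightarrow> j < d \<Longrightarrow> (\<Sum>x\<in>X. \<delta> i x * f j x) = (if i = j then 1 else 0)"
    and J: "J = mat d d (\<lambda>(i,j). \<Sum>x\<in>X. f i x * f j x / p x)"
    and V: "V = mat d d (\<lambda>(i,j). \<Sum>x\<in>X. \<delta> i x * \<delta> j x * p x)"
    and I: "I \<in> carrier_mat d d" "I * J = 1\<^sub>m d" and G: "rpsd d G"
  shows "mtrace (G * I) \<le> mtrace (G * V)"
proof -
  have Gc: "G \<in> carrier_mat d d" using G by (simp add: rpsd_def)
  have Vc: "V \<in> carrier_mat d d" and Jc: "J \<in> carrier_mat d d" by (auto simp: V J)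
  define u where "u i x = (\<Sum>k<d. I $$ (i,k) * f k x)" for i x
  define y where "y i x = \<delta> i x - u i x / p x" for i x
  \<comment> \<open>At outcomes of probability 0 the cross terms \<open>\<delta> i x * u j x\<close>
    carry no factor \<open>p x\<close>, so they vanish only because \<open>u\<close> does.\<close>
  have u0: "u i x = 0" if "x \<in> X" "p x = 0" for i x
    unfolding u_def using f0[OF _ that] by simp
  have du: "(\<Sum>x\<in>X. \<delta> i x * u j x) = I $$ (j,i)" if "i < d" "j < d" for i j
  proof -
    have "(\<Sum>x\<in>X. \<delta> i x * u j x) = (\<Sum>k<d. I $$ (j,k) * (\<Sum>x\<in>X. \<delta> i x * f k x))"
      unfolding u_def sum_distrib_left by (subst sum.swap) (simp add: mult_ac)
    also have "\<dots> = (\<Sum>k<d. if k = i then I $$ (j,i) else 0)"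
      by (intro sum.cong refl) (use that unb in auto)
    finally show ?thesis using that by simp
  qed
  have uu: "(\<Sum>x\<in>X. u i x * u j x / p x) = I $$ (j,i)" if "i < d" "j < d" for i j
  proof -
    have "(\<Sum>x\<in>X. u i x * u j x / p x) = (\<Sum>x\<in>X. \<Sum>k<d. \<Sum>l<d. I $$ (i,k) * (f k x * f l x / p x) * I $$ (j,l))"
      unfolding u_def sum_product sum_divide_distrib by (simp add: mult_ac)
    also have "\<dots> = (\<Sum>k<d. \<Sum>l<d. \<Sum>x\<in>X. I $$ (i,k) * (f k x * f l x / p x) * I $$ (j,l))"
      by (simp only: sum.swap[of _ X])
    also have "\<dots> = (\<Sum>k<d. \<Sum>l<d. I $$ (i,k) * J $$ (k,l) * I $$ (j,l))"
      by (intro sum.cong refl) (simp add: J sum_distrib_left sum_distrib_right)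
    also have "\<dots> = (\<Sum>l<d. (\<Sum>k<d. I $$ (i,k) * J $$ (k,l)) * I $$ (j,l))"
      unfolding sum_distrib_right by (rule sum.swap)
    also have "\<dots> = (\<Sum>l<d. (I * J) $$ (i,l) * I $$ (j,l))"
      using that by (intro sum.cong refl) (simp only: index_mult_mat_sum[OF I(1) Jc] lessThan_iff)
    also have "\<dots> = (\<Sum>l<d. if l = i then I $$ (j,i) else 0)"
      unfolding I(2) using that by (intro sum.cong refl) auto
    finally show ?thesis using that by simp
  qed
  have key: "(\<Sum>x\<in>X. p x * (y i x * y j x)) = V $$ (i,j) - I $$ (i,j)" if ij: "i < d" "j < d" for i j
  proof -
    have "(\<Sum>x\<in>X. p x * (y i x * y j x)) = (\<Sum>x\<in>X. \<delta> i x * \<delta> j x * p x - \<delta> i x * u j x - \<delta> j x * u i x + u i x * u j x / p x)"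
    proof (rule sum.cong[OF refl])
      fix x assume x: "x \<in> X"
      show "p x * (y i x * y j x) = \<delta> i x * \<delta> j x * p x - \<delta> i x * u j x - \<delta> j x * u i x + u i x * u j x / p x"
        using u0[OF x] by (cases "p x = 0") (auto simp: y_def field_simps)
    qed
    also have "\<dots> = V $$ (i,j) - I $$ (j,i) - I $$ (i,j) + I $$ (j,i)"
      using ij by (simp add: sum.distrib sum_subtractf du uu) (simp add: V)
    finally show ?thesis by simp
  qed
  have "0 \<le> (\<Sum>x\<in>X. p x * (\<Sum>i<d. \<Sum>j<d. y i x * G $$ (i,j) * y j x))"
    using p rpsd_form_nonneg[OF G] by (auto intro!: sum_nonneg)
  also have "\<dots> = (\<Sum>x\<in>X. \<Sum>i<d. \<Sum>j<d. G $$ (i,j) * (p x * (y j x * y i x)))"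
    by (simp add: sum_distrib_left mult_ac)
  also have "\<dots> = (\<Sum>i<d. \<Sum>j<d. \<Sum>x\<in>X. G $$ (i,j) * (p x * (y j x * y i x)))"
    by (simp only: sum.swap[of _ X])
  also have "\<dots> = (\<Sum>i<d. \<Sum>j<d. G $$ (i,j) * (V $$ (j,i) - I $$ (j,i)))"
    by (intro sum.cong refl) (simp add: sum_distrib_left[symmetric] key)
  also have "\<dots> = mtrace (G * V) - mtrace (G * I)"
    by (simp add: mtrace_mult[OF Gc Vc] mtrace_mult[OF Gc I(1)] sum_subtractf right_diff_distrib)
  finally show ?thesis by simp
qed

section \<open>The quantum statistical model\<close>

text \<open>The choice inside \<open>mono_metric\<close> mentions neither \<open>P\<close> nor the
  two arguments, so one eigenbasis serves all metrics at \<open>rho\<close> simultaneously. Testing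
  \<open>rho\<close> on the eigenvectors makes the eigenvalues positive.\<close>

lemma mono_metric_eigen:
  assumes rho: "rho \<in> carrier_mat n n" "spd rho"
  obtains U lam where "unitary U" "dim_row U = n" "rho = U * rdiag n lam * adj U"
    "\<And>i. i < n \<Longrightarrow> 0 < lam i"
    "\<And>P X Y. mono_metric P rho X Y = (\<Sum>a<n. \<Sum>b<n. cnj ((adj U * X * U) $$ (a,b)) * (adj U * Y * U) $$ (a,b)
        / complex_of_real (lam b * P (lam a / lam b)))"
proof -
  define sel where "sel = (SOME (U, lam). unitary U \<and> dim_row U = n \<and> rho = U * rdiag n lam * adj U)"
  have "\<exists>z. case z of (U, lam) \<Rightarrow> unitary U \<and> dim_row U = n \<and> rho = U * rdiag n lam * adj U"
    using spectral_theorem[of rho n] rho by (auto simp: spd_def)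
  then have "case sel of (U, lam) \<Rightarrow> unitary U \<and> dim_row U = n \<and> rho = U * rdiag n lam * adj U"
    unfolding sel_def by (rule someI_ex)
  then obtain U lam where sel: "sel = (U, lam)" and U: "unitary U" "dim_row U = n" "rho = U * rdiag n lam * adj U"
    by (cases sel) auto
  note u = unitaryD[OF U(1,2)]
  have pos: "0 < lam i" if i: "i < n" for i
  proof -
    define v where "v = U *\<^sub>v unit_vec n i"
    have v: "v \<in> carrier_vec n" using u by (intro carrier_vecI) (simp add: v_def)
    have adjv: "adj U *\<^sub>v v = unit_vec n i"
      unfolding v_def using u by (simp add: assoc_mult_mat_vec_dim[symmetric])
    have "v \<noteq> 0\<^sub>v n"
    proof
      assume "v = 0\<^sub>v n"
      then have "unit_vec n i = adj U *\<^sub>v 0\<^sub>v n" using adjv by simp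
      also have "\<dots> = 0\<^sub>v n" using u(1) by (intro eq_vecI) auto
      finally show False using i by (metis index_unit_vec(1) index_zero_vec(1) zero_neq_one)
    qed
    then have "0 < Re (cinner v (rho *\<^sub>v v))" using rho v by (auto simp: spd_def)
    also have "cinner v (rho *\<^sub>v v) = complex_of_real (\<Sum>k<n. lam k * (cmod (unit_vec n i $ k))\<^sup>2)"
      unfolding U(3) by (subst cinner_diag_conj[OF u(1) v]) (simp add: adjv)
    also have "(\<Sum>k<n. lam k * (cmod (unit_vec n i $ k :: complex))\<^sup>2) = (\<Sum>k<n. if k = i then lam i else 0)"
      using i by (intro sum.cong refl) auto
    finally show ?thesis using i by simp
  qed
  have "mono_metric P rho X Y = (\<Sum>a<n. \<Sum>b<n. cnj ((adj U * X * U) $$ (a,b)) * (adj U * Y * U) $$ (a,b)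
        / complex_of_real (lam b * P (lam a / lam b)))" for P X Y
    using rho(1) sel unfolding mono_metric_def Let_def sel_def by simp
  then show ?thesis using that U pos by blast
qed

lemma map_cnj_mult:
  assumes "A \<in> carrier_mat n m" "B \<in> carrier_mat m k"
  shows "map_mat cnj (A * B) = map_mat cnj A * map_mat cnj B"
  by (rule eq_matI) (use assms in \<open>auto simp: scalar_prod_def\<close>)

section \<open>Derivatives of the state at the base point\<close>

context
  fixes rho :: "real^'d \<Rightarrow> complex mat" and \<Theta> :: "(real^'d) set" and \<theta>0 :: "real^'d" and n :: nat
  assumes \<Theta>: "open \<Theta>" "\<theta>0 \<in> \<Theta>" and dens: "\<forall>\<theta>\<in>\<Theta>. density n (rho \<theta>)"
    and smooth: "\<forall>a<n. \<forall>b<n. smooth_on \<Theta> (\<lambda>\<theta>. rho \<theta> $$ (a,b))"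
begin

lemma pderiv_rho_carrier: "pderiv_rho rho \<theta>0 i \<in> carrier_mat n n"
  using \<Theta> dens by (auto simp: pderiv_rho_def density_def)

text \<open>The first level of \<open>Ck_on\<close> turns the total function
  \<open>vector_derivative\<close> into a genuine derivative.\<close>

lemma pderiv_rho_derivative:
  assumes "a < n" "b < n"
  shows "((\<lambda>t. rho (\<theta>0 + t *\<^sub>R axis (eidx i) 1) $$ (a,b)) has_vector_derivative pderiv_rho rho \<theta>0 i $$ (a,b)) (at 0)"
proof -
  have "Ck_on (Suc 0) \<Theta> (\<lambda>\<theta>. rho \<theta> $$ (a,b))" using smooth assms unfolding smooth_on_def by blast
  then obtain g where "\<forall>x\<in>\<Theta>. ((\<lambda>t. rho (x + t *\<^sub>R axis (eidx i) 1) $$ (a,b)) has_vector_derivative g x) (at 0)"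
    by auto
  then have "((\<lambda>t. rho (\<theta>0 + t *\<^sub>R axis (eidx i) 1) $$ (a,b)) has_vector_derivative g \<theta>0) (at 0)"
    using \<Theta> by blast
  moreover have "pderiv_rho rho \<theta>0 i $$ (a,b) = vector_derivative (\<lambda>t. rho (\<theta>0 + t *\<^sub>R axis (eidx i) 1) $$ (a,b)) (at 0)"
    using assms \<Theta> dens by (auto simp: pderiv_rho_def density_def)
  ultimately show ?thesis by (simp add: vector_derivative_at)
qed

text \<open>Hermiticity and unit trace hold inside \<open>\<Theta>\<close>; this neighbourhood of 0
  is where these identities can be differentiated.\<close>

lemma open_parameter_line: "open {t::real. \<theta>0 + t *\<^sub>R v \<in> \<Theta>}" "0 \<in> {t::real. \<theta>0 + t *\<^sub>R v \<in> \<Theta>}"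
proof -
  have "open ((\<lambda>t. \<theta>0 + t *\<^sub>R v) -` \<Theta>)"
    by (rule open_vimage[OF \<Theta>(1)]) (intro continuous_intros)
  then show "open {t::real. \<theta>0 + t *\<^sub>R v \<in> \<Theta>}" by (simp add: vimage_def)
  show "0 \<in> {t::real. \<theta>0 + t *\<^sub>R v \<in> \<Theta>}" using \<Theta> by simp
qed

lemma hermitian_pderiv_rho: "hermitian (pderiv_rho rho \<theta>0 i)"
  unfolding hermitian_iff[OF pderiv_rho_carrier]
proof (intro allI impI)
  fix a b assume ab: "a < n" "b < n"
  let ?r = "\<lambda>t. rho (\<theta>0 + t *\<^sub>R axis (eidx i) 1)"
  have "((\<lambda>t. cnj (?r t $$ (b,a))) has_vector_derivative cnj (pderiv_rho rho \<theta>0 i $$ (b,a))) (at 0)"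
    by (rule has_vector_derivative_cnj[OF pderiv_rho_derivative[OF ab(2,1)]])
  then have "((\<lambda>t. ?r t $$ (a,b)) has_vector_derivative cnj (pderiv_rho rho \<theta>0 i $$ (b,a))) (at 0)"
  proof (rule has_vector_derivative_transform_within_open[OF _ open_parameter_line])
    fix t :: real assume "t \<in> {t. \<theta>0 + t *\<^sub>R axis (eidx i) 1 \<in> \<Theta>}"
    then have "?r t \<in> carrier_mat n n" "hermitian (?r t)" using dens by (auto simp: density_def psd_def)
    then show "cnj (?r t $$ (b,a)) = ?r t $$ (a,b)" using ab by (simp add: hermitian_iff)
  qed
  then show "cnj (pderiv_rho rho \<theta>0 i $$ (b,a)) = pderiv_rho rho \<theta>0 i $$ (a,b)"
    using pderiv_rho_derivative[OF ab] vector_derivative_unique_at by blast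
qed

text \<open>The trace is constantly 1 near the base point. This is what lets an estimate be
  recentred at \<open>\<theta>0\<close> without changing its pairing with the derivatives.\<close>

lemma mtrace_pderiv_rho: "mtrace (pderiv_rho rho \<theta>0 i) = 0"
proof -
  let ?r = "\<lambda>t. rho (\<theta>0 + t *\<^sub>R axis (eidx i) 1)"
  have "((\<lambda>t. \<Sum>a<n. ?r t $$ (a,a)) has_vector_derivative (\<Sum>a<n. pderiv_rho rho \<theta>0 i $$ (a,a))) (at 0)"
    by (intro has_vector_derivative_sum pderiv_rho_derivative) auto
  then have "((\<lambda>t. 1) has_vector_derivative (\<Sum>a<n. pderiv_rho rho \<theta>0 i $$ (a,a))) (at 0)"
  proof (rule has_vector_derivative_transform_within_open[OF _ open_parameter_line])
    fix t :: real assume "t \<in> {t. \<theta>0 + t *\<^sub>R axis (eidx i) 1 \<in> \<Theta>}"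
    then have "?r t \<in> carrier_mat n n" "mtrace (?r t) = 1" using dens by (auto simp: density_def)
    then show "(\<Sum>a<n. ?r t $$ (a,a)) = 1" by (simp add: mtrace_def)
  qed
  then have "(\<Sum>a<n. pderiv_rho rho \<theta>0 i $$ (a,a)) = 0"
    using vector_derivative_unique_at has_vector_derivative_const by blast
  then show ?thesis using pderiv_rho_carrier[of i] by (simp add: mtrace_def)
qed

end

section \<open>Traces and measurements in the eigenbasis of the state\<close>

lemma mtrace_mult_unitary_conj:
  assumes U: "unitary U" "dim_row U = n" and A: "A \<in> carrier_mat n n" and B: "B \<in> carrier_mat n n"
  shows "mtrace (A * B) = (\<Sum>a<n. \<Sum>b<n. (adj U * A * U) $$ (a,b) * (adj U * B * U) $$ (b,a))"
proof -
  note u = unitaryD[OF U]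
  have car: "adj U * C * U \<in> carrier_mat n n" if "C \<in> carrier_mat n n" for C
    by (rule sandwich_carrier[OF adj_carrier[OF u(1)] that u(1)])
  have "(adj U * A * U) * (adj U * B * U) = adj U * A * (U * adj U) * B * U"
    using u(1) A B by (simp add: assoc_mult_mat_dim)
  also have "\<dots> = adj U * (A * B) * U" unfolding u(3) using u(1) A B by (simp add: assoc_mult_mat_dim)
  finally have "mtrace ((adj U * A * U) * (adj U * B * U)) = mtrace (A * B)"
    using mtrace_unitary_conj(2)[OF U, of "A * B"] A B by auto
  then show ?thesis using mtrace_mult[OF car[OF A] car[OF B]] by simp
qed

text \<open>The real parts taken in \<open>classical_fisher\<close> lose nothing, so
  \<open>f i x\<close> may be replaced by the full complex trace.\<close>

lemma mtrace_mult_hermitian_real: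
  assumes A: "A \<in> carrier_mat n n" "hermitian A" and B: "B \<in> carrier_mat n n" "hermitian B"
  shows "mtrace (A * B) = complex_of_real (Re (mtrace (A * B)))"
proof -
  have "cnj (mtrace (A * B)) = (\<Sum>i<n. \<Sum>j<n. A $$ (j,i) * B $$ (i,j))"
    unfolding mtrace_mult[OF A(1) B(1)] cnj_sum using A B
    by (intro sum.cong refl) (auto simp: hermitian_iff[of _ n])
  also have "\<dots> = mtrace (A * B)" unfolding mtrace_mult[OF A(1) B(1)] by (rule sum.swap)
  finally show ?thesis by (simp add: complex_eq_iff)
qed

lemma POVM_unitary_conj:
  assumes U: "unitary U" "dim_row U = n" and M: "is_POVM n X M" and ab: "a < n" "b < n"
  shows "(\<Sum>x\<in>X. (adj U * M x * U) $$ (a,b)) = (if a = b then 1 else 0)"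
proof -
  note u = unitaryD[OF U]
  have sand: "(adj U * C * U) $$ (a,b) = (\<Sum>k<n. (\<Sum>l<n. adj U $$ (a,l) * C $$ (l,k)) * U $$ (k,b))"
    if C: "C \<in> carrier_mat n n" for C
  proof -
    have "adj U * C \<in> carrier_mat n n" by (rule mult_carrier_mat[OF adj_carrier[OF u(1)] C])
    then have "(adj U * C * U) $$ (a,b) = (\<Sum>k<n. (adj U * C) $$ (a,k) * U $$ (k,b))"
      by (rule index_mult_mat_sum[OF _ u(1) ab])
    also have "\<dots> = (\<Sum>k<n. (\<Sum>l<n. adj U $$ (a,l) * C $$ (l,k)) * U $$ (k,b))"
      using ab by (intro sum.cong refl) (simp only: index_mult_mat_sum[OF adj_carrier[OF u(1)] C] lessThan_iff)
    finally show ?thesis .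
  qed
  have Mc: "M x \<in> carrier_mat n n" if "x \<in> X" for x using M that by (simp add: is_POVM_def)
  have one: "(\<Sum>x\<in>X. M x $$ (l,k)) = 1\<^sub>m n $$ (l,k)" if "l < n" "k < n" for l k
  proof -
    have "msum n X M $$ (l,k) = 1\<^sub>m n $$ (l,k)" using M by (simp add: is_POVM_def)
    then show ?thesis using that by (simp add: msum_def)
  qed
  have "(\<Sum>x\<in>X. (adj U * M x * U) $$ (a,b)) = (\<Sum>x\<in>X. \<Sum>k<n. \<Sum>l<n. adj U $$ (a,l) * M x $$ (l,k) * U $$ (k,b))"
    by (intro sum.cong refl) (simp add: sand[OF Mc] sum_distrib_right)
  also have "\<dots> = (\<Sum>k<n. \<Sum>l<n. \<Sum>x\<in>X. adj U $$ (a,l) * M x $$ (l,k) * U $$ (k,b))"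
    by (simp only: sum.swap[of _ X])
  also have "\<dots> = (\<Sum>k<n. \<Sum>l<n. adj U $$ (a,l) * 1\<^sub>m n $$ (l,k) * U $$ (k,b))"
    by (intro sum.cong refl) (simp only: sum_distrib_left[symmetric] sum_distrib_right[symmetric] one lessThan_iff)
  also have "\<dots> = (adj U * 1\<^sub>m n * U) $$ (a,b)" by (simp only: sand[OF one_carrier_mat] sum_distrib_right)
  also have "adj U * 1\<^sub>m n * U = 1\<^sub>m n" using u by simp
  finally show ?thesis using ab by simp
qed

theorem theorem1:
  fixes rho :: "real^'d \<Rightarrow> complex mat"
    and \<Theta> :: "(real^'d) set"
    and \<theta>0 :: "real^'d"
    and n :: nat
    and X :: "'x set"
    and M :: "'x \<Rightarrow> complex mat"
    and est :: "'x \<Rightarrow> real^'d"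
    and G :: "real mat"
    and P :: "real \<Rightarrow> real"
    and \<beta> :: real
  assumes "open \<Theta>" and "\<theta>0 \<in> \<Theta>"
    and "\<forall>\<theta>\<in>\<Theta>. density n (rho \<theta>)"
    and "\<forall>a<n. \<forall>b<n. smooth_on \<Theta> (\<lambda>\<theta>. rho \<theta> $$ (a,b))"
    and "spd (rho \<theta>0)"
    and "is_POVM n X M"
    and "\<forall>x\<in>X. est x \<in> \<Theta>"
    and "locally_unbiased rho \<theta>0 X M est"
    and "rpsd CARD('d) G"
    and "\<forall>x>0. P x > 0"
    and "operator_monotone P"
    and "P 1 = 1"
    and "-1 \<le> \<beta>" and "\<beta> \<le> 1"
    and "(P has_real_derivative ((1 + \<beta>) / 2)) (at 1)"
    and "invertible_mat (classical_fisher rho \<theta>0 X M)"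
    and "invertible_mat (quantum_fisher P rho \<theta>0)"
    and "invertible_mat (quantum_fisher (P_beta \<bar>\<beta>\<bar>) rho \<theta>0)"
  shows "mtrace (G * covariance rho \<theta>0 X M est) \<ge> mtrace (G * minv (classical_fisher rho \<theta>0 X M))
       \<and> mtrace (G * minv (classical_fisher rho \<theta>0 X M)) \<ge> C_bound G (quantum_fisher (P_beta \<bar>\<beta>\<bar>) rho \<theta>0)
       \<and> C_bound G (quantum_fisher (P_beta \<bar>\<beta>\<bar>) rho \<theta>0) \<ge> C_bound G (quantum_fisher P rho \<theta>0)"
proof -
  define d where "d = CARD('d)"
  define D where "D = pderiv_rho rho \<theta>0"
  have Dc: "D i \<in> carrier_mat n n" and Dh: "hermitian (D i)" and Dt: "mtrace (D i) = 0" for i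
    unfolding D_def by (rule pderiv_rho_carrier[OF assms(1-4)] hermitian_pderiv_rho[OF assms(1-4)]
        mtrace_pderiv_rho[OF assms(1-4)])+
  have rhoc: "rho \<theta>0 \<in> carrier_mat n n" using assms(2,3) by (auto simp: density_def)
  have X: "finite X" and Mc: "x \<in> X \<Longrightarrow> M x \<in> carrier_mat n n" and Mp: "x \<in> X \<Longrightarrow> psd (M x)" for x
    using assms(6) by (auto simp: is_POVM_def)
  have G: "rpsd d G" using assms(9) by (simp add: d_def)
  obtain U lam where U: "unitary U" "dim_row U = n" "rho \<theta>0 = U * rdiag n lam * adj U"
    and lam: "\<And>i. i < n \<Longrightarrow> 0 < lam i"
    and metric: "\<And>P X Y. mono_metric P (rho \<theta>0) X Y =
        (\<Sum>a<n. \<Sum>b<n. cnj ((adj U * X * U) $$ (a,b)) * (adj U * Y * U) $$ (a,b) / complex_of_real (lam b * P (lam a / lam b)))"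
    by (rule mono_metric_eigen[OF rhoc assms(5)]) (rule that)
  note u = unitaryD[OF U(1,2)]
  \<comment> \<open>Derivatives and effects are moved to the eigenbasis of the state; pairs
    \<open>k = (a,b)\<close> index the matrix units on which every metric acts by the scalar weight
    \<open>wt P k\<close>.\<close>
  define E where "E i = adj U * D i * U" for i
  define N where "N x = adj U * M x * U" for x
  define K where "K = {..<n} \<times> {..<n}"
  define e where "e i k = E i $$ k" for i k
  define wt where "wt P = (\<lambda>(a,b). lam b * P (lam a / lam b))" for P :: "real \<Rightarrow> real"
  define f where "f i x = Re (mtrace (D i * M x))" for i x
  define p where "p x = Re (mtrace (rho \<theta>0 * M x))" for x
  have Ec: "E i \<in> carrier_mat n n" for i
    unfolding E_def by (rule sandwich_carrier[OF adj_carrier[OF u(1)] Dc u(1)])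
  have Nc: "N x \<in> carrier_mat n n" if "x \<in> X" for x
    unfolding N_def by (rule sandwich_carrier[OF adj_carrier[OF u(1)] Mc[OF that] u(1)])
  have Np: "psd (N x)" if "x \<in> X" for x
    unfolding N_def by (rule psd_congruence[OF Mc[OF that] Mp[OF that] u(1)])
  have N1: "(\<Sum>x\<in>X. N x $$ (a,c)) = (if a = c then 1 else 0)" if "a < n" "c < n" for a c
    unfolding N_def by (rule POVM_unitary_conj[OF U(1,2) assms(6) that])
  have Eherm: "cnj (E i $$ (b,a)) = E i $$ (a,b)" if "a < n" "b < n" for i a b
  proof -
    have "adj (E i) = E i"
      unfolding E_def using u(1) Dc[of i] Dh[of i] by (simp add: adj_mult_dim assoc_mult_mat_dim hermitianD)
    then have "hermitian (E i)" using Ec[of i] by (auto simp: hermitian_def)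
    then show ?thesis using that Ec[of i] by (simp add: hermitian_iff)
  qed
  have trE: "complex_of_real (f i x) = (\<Sum>a<n. \<Sum>b<n. E i $$ (a,b) * N x $$ (b,a))" if x: "x \<in> X" for i x
    unfolding f_def E_def N_def
    using mtrace_mult_hermitian_real[OF Dc Dh Mc[OF x] psd_imp_hermitian[OF Mp[OF x]], of i]
      mtrace_mult_unitary_conj[OF U(1,2) Dc Mc[OF x], of i] by simp
  have trp: "p x = (\<Sum>a<n. lam a * Re (N x $$ (a,a)))" if x: "x \<in> X" for x
  proof -
    have "adj U * rho \<theta>0 * U = (adj U * U) * rdiag n lam * (adj U * U)"
      using u(1) by (simp add: U(3) assoc_mult_mat_dim)
    then have "adj U * rho \<theta>0 * U = rdiag n lam" using u by simp
    then have "mtrace (rho \<theta>0 * M x) = (\<Sum>a<n. \<Sum>b<n. rdiag n lam $$ (a,b) * N x $$ (b,a))"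
      unfolding N_def mtrace_mult_unitary_conj[OF U(1,2) rhoc Mc[OF x]] by simp
    also have "\<dots> = (\<Sum>a<n. \<Sum>b<n. if b = a then complex_of_real (lam a) * N x $$ (a,a) else 0)"
      by (intro sum.cong refl) auto
    finally show ?thesis by (simp add: p_def)
  qed
  have p0: "0 \<le> p x" if "x \<in> X" for x
    unfolding trp[OF that] using psd_diag_nonneg[OF Nc[OF that] Np[OF that]] lam
    by (auto intro!: sum_nonneg mult_nonneg_nonneg simp: less_imp_le)
  have f0: "f i x = 0" if x: "x \<in> X" and px: "p x = 0" for i x
  proof -
    \<comment> \<open>Dividing by the positive eigenvalues writes \<open>f i x\<close> as the
      weighted pairing of the basis with \<open>v\<close>, which is bounded by a multiple of
      \<open>p x\<close>.\<close>
    define v where "v k c = E i $$ (c,k) / complex_of_real (lam k)" for k c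
    have "(cmod (\<Sum>k<n. \<Sum>c<n. complex_of_real (lam k) * (N x $$ (k,c) * v k c)))\<^sup>2 \<le> p x *
       Re (\<Sum>k<n. complex_of_real (lam k) * (\<Sum>a<n. \<Sum>c<n. cnj (v k a) * N x $$ (a,c) * v k c))"
      unfolding trp[OF x] by (rule psd_weighted_cauchy_schwarz[OF Nc[OF x] Np[OF x]]) (use lam in \<open>simp add: less_imp_le\<close>)
    then have z: "(\<Sum>k<n. \<Sum>c<n. complex_of_real (lam k) * (N x $$ (k,c) * v k c)) = 0" using px by simp
    have "(\<Sum>k<n. \<Sum>c<n. complex_of_real (lam k) * (N x $$ (k,c) * v k c)) = (\<Sum>k<n. \<Sum>c<n. E i $$ (c,k) * N x $$ (k,c))"
      by (intro sum.cong refl) (use lam in \<open>force simp: v_def\<close>)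
    also have "\<dots> = complex_of_real (f i x)" unfolding trE[OF x] by (rule sum.swap)
    finally show ?thesis using z by simp
  qed
  have JM: "classical_fisher rho \<theta>0 X M = mat d d (\<lambda>(i,j). \<Sum>x\<in>X. f i x * f j x / p x)"
    by (simp add: classical_fisher_def d_def f_def p_def D_def)
  have JMc: "classical_fisher rho \<theta>0 X M \<in> carrier_mat d d" by (simp add: JM)
  note invM = minv_inverse[OF JMc assms(16)]
  have part1: "mtrace (G * minv (classical_fisher rho \<theta>0 X M)) \<le> mtrace (G * covariance rho \<theta>0 X M est)"
  proof (rule classical_cramer_rao[OF X p0 _ _ JM _ invM(1,3) G])
    show "covariance rho \<theta>0 X M est = mat d d (\<lambda>(i,j). \<Sum>x\<in>X.
        (vec_nth (est x) (eidx i) - vec_nth \<theta>0 (eidx i)) * (vec_nth (est x) (eidx j) - vec_nth \<theta>0 (eidx j)) * p x)"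
      by (simp add: covariance_def d_def p_def)
    fix i j assume ij: "i < d" "j < d"
    have "(\<Sum>x\<in>X. complex_of_real (vec_nth (est x) (eidx i)) * mtrace (D j * M x)) = (if i = j then 1 else 0)"
      using assms(8) ij by (simp add: locally_unbiased_def d_def D_def)
    from arg_cong[OF this, of Re] have 1: "(\<Sum>x\<in>X. vec_nth (est x) (eidx i) * f j x) = (if i = j then 1 else 0)"
      by (simp add: f_def)
    \<comment> \<open>The effects sum to the identity, so these derivatives sum to the trace of
      \<open>D j\<close>, which is 0; subtracting \<open>\<theta>0\<close> then preserves the
      unbiasedness relations.\<close>
    have "(\<Sum>x\<in>X. mtrace (D j * M x)) = (\<Sum>a<n. \<Sum>b<n. D j $$ (a,b) * (\<Sum>x\<in>X. M x $$ (b,a)))"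
    proof -
      have "(\<Sum>x\<in>X. mtrace (D j * M x)) = (\<Sum>x\<in>X. \<Sum>a<n. \<Sum>b<n. D j $$ (a,b) * M x $$ (b,a))"
        by (intro sum.cong refl) (simp add: mtrace_mult[OF Dc Mc])
      then show ?thesis by (simp only: sum.swap[of _ X] sum_distrib_left)
    qed
    also have "\<dots> = (\<Sum>a<n. \<Sum>b<n. if b = a then D j $$ (a,a) else 0)"
    proof (intro sum.cong refl)
      fix a b assume ab: "a \<in> {..<n}" "b \<in> {..<n}"
      have "msum n X M $$ (b,a) = 1\<^sub>m n $$ (b,a)" using assms(6) by (simp add: is_POVM_def)
      then show "D j $$ (a,b) * (\<Sum>x\<in>X. M x $$ (b,a)) = (if b = a then D j $$ (a,a) else 0)"
        using ab by (simp add: msum_def)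
    qed
    also have "\<dots> = mtrace (D j)" using Dc[of j] by (simp add: mtrace_def)
    finally have "Re (\<Sum>x\<in>X. mtrace (D j * M x)) = 0" by (simp add: Dt)
    then have 2: "(\<Sum>x\<in>X. f j x) = 0" by (simp add: f_def)
    show "(\<Sum>x\<in>X. (vec_nth (est x) (eidx i) - vec_nth \<theta>0 (eidx i)) * f j x) = (if i = j then 1 else 0)"
      using 1 2 by (simp add: left_diff_distrib sum_subtractf sum_distrib_left[symmetric])
  qed (use f0 in auto)
  have JQ: "quantum_fisher Q rho \<theta>0 = gram d K e (wt Q)" for Q
    unfolding quantum_fisher_def gram_def D_def[symmetric] d_def[symmetric] metric E_def[symmetric] K_def
    by (rule cong_mat) (auto simp: sum.cartesian_product e_def wt_def intro!: sum.cong)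
  have Jbc: "quantum_fisher Q rho \<theta>0 \<in> carrier_mat d d" for Q by (simp add: JQ)
  note invb = minv_inverse[OF Jbc assms(18)]
  note invP = minv_inverse[OF Jbc assms(17)]
  have hb: "hermitian (minv (quantum_fisher (P_beta \<bar>\<beta>\<bar>) rho \<theta>0))"
    by (rule hermitian_inverse[OF Jbc _ invb(1,2)]) (simp add: JQ hermitian_gram)
  have hP: "hermitian (minv (quantum_fisher P rho \<theta>0))"
    by (rule hermitian_inverse[OF Jbc _ invP(1,2)]) (simp add: JQ hermitian_gram)
  have wtb: "0 < wt (P_beta \<bar>\<beta>\<bar>) k" if kK: "k \<in> K" for k
  proof -
    obtain a b where k: "k = (a,b)" "a < n" "b < n" using kK by (auto simp: K_def)
    have "0 < P_beta \<bar>\<beta>\<bar> (lam a / lam b)"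
      unfolding P_beta_def using assms(13,14) lam[OF k(2)] lam[OF k(3)]
      by (intro add_pos_nonneg mult_pos_pos) (auto simp: abs_le_iff)
    then show ?thesis using lam[OF k(3)] by (simp add: wt_def k(1))
  qed
  have part2: "C_bound G (quantum_fisher (P_beta \<bar>\<beta>\<bar>) rho \<theta>0) \<le> mtrace (G * minv (classical_fisher rho \<theta>0 X M))"
  proof -
    let ?JM = "map_mat complex_of_real (classical_fisher rho \<theta>0 X M)"
    let ?IM = "map_mat complex_of_real (minv (classical_fisher rho \<theta>0 X M))"
    have JMg: "?JM = gram d X (\<lambda>i x. complex_of_real (f i x)) p"
      unfolding JM gram_def by (rule eq_matI) auto
    have IM: "?IM \<in> carrier_mat d d" using invM(1) by simp
    have I: "?JM * ?IM = 1\<^sub>m d"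
      unfolding of_real_hom.mat_hom_mult[OF JMc invM(1), symmetric] invM(2) by (rule of_real_hom.mat_hom_one)
    have pM: "psd ?JM" unfolding JMg by (rule psd_gram[OF p0])
    have "psd (quantum_fisher (P_beta \<bar>\<beta>\<bar>) rho \<theta>0 - ?JM)"
      unfolding JQ JMg
    proof (rule psd_gram_diff)
      fix v :: "nat \<Rightarrow> complex"
      \<comment> \<open>The quantum matrix is complex, so complex \<open>v\<close> must be tested
        and \<open>Y\<close> need not be Hermitian.\<close>
      define Y where "Y a b = (\<Sum>i<d. v i * E i $$ (a,b))" for a b
      have "(\<Sum>x\<in>X. (cmod (\<Sum>i<d. v i * complex_of_real (f i x)))\<^sup>2 / p x) =
          (\<Sum>x\<in>X. (cmod (\<Sum>a<n. \<Sum>b<n. Y a b * N x $$ (b,a)))\<^sup>2 / (\<Sum>a<n. lam a * Re (N x $$ (a,a))))"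
      proof (rule sum.cong[OF refl])
        fix x assume x: "x \<in> X"
        have "(\<Sum>i<d. v i * complex_of_real (f i x)) = (\<Sum>i<d. \<Sum>a<n. \<Sum>b<n. v i * E i $$ (a,b) * N x $$ (b,a))"
          unfolding trE[OF x] by (simp add: sum_distrib_left mult.assoc)
        also have "\<dots> = (\<Sum>a<n. \<Sum>b<n. \<Sum>i<d. v i * E i $$ (a,b) * N x $$ (b,a))"
          by (subst sum.swap, rule sum.cong[OF refl], rule sum.swap)
        also have "\<dots> = (\<Sum>a<n. \<Sum>b<n. Y a b * N x $$ (b,a))"
          unfolding Y_def sum_distrib_right ..
        finally show "(cmod (\<Sum>i<d. v i * complex_of_real (f i x)))\<^sup>2 / p x =
          (cmod (\<Sum>a<n. \<Sum>b<n. Y a b * N x $$ (b,a)))\<^sup>2 / (\<Sum>a<n. lam a * Re (N x $$ (a,a)))"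
          unfolding trp[OF x] by (simp only:)
      qed
      also have "\<dots> \<le> (\<Sum>a<n. \<Sum>b<n. (cmod (Y a b))\<^sup>2 / (lam b * P_beta \<bar>\<beta>\<bar> (lam a / lam b)))"
        by (rule measured_fisher_le[OF X lam _ _ _ N1]) (use assms(13,14) Nc Np in auto)
      also have "\<dots> = (\<Sum>k\<in>K. (cmod (\<Sum>i<d. v i * e i k))\<^sup>2 / wt (P_beta \<bar>\<beta>\<bar>) k)"
        unfolding K_def sum.cartesian_product by (rule sum.cong) (auto simp: Y_def e_def wt_def)
      finally show "(\<Sum>x\<in>X. (cmod (\<Sum>i<d. v i * complex_of_real (f i x)))\<^sup>2 / p x)
          \<le> (\<Sum>k\<in>K. (cmod (\<Sum>i<d. v i * e i k))\<^sup>2 / wt (P_beta \<bar>\<beta>\<bar>) k)" .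
    qed
    then have "psd (?IM - minv (quantum_fisher (P_beta \<bar>\<beta>\<bar>) rho \<theta>0))"
      using psd_inverse_diff[OF Jbc _ _ pM _ invb(1,2) IM I] JMc by (simp add: JQ hermitian_gram)
    then have "C_value G (minv (quantum_fisher (P_beta \<bar>\<beta>\<bar>) rho \<theta>0)) \<le> C_value G ?IM"
      using C_value_mono[OF G invb(1) hb IM hermitian_inverse[OF _ psd_imp_hermitian[OF pM] IM I]] JMc by simp
    then show ?thesis by (simp add: C_bound_eq_C_value C_value_of_real[OF G invM(1)])
  qed
  have tangent: "P x \<le> P_beta \<beta> x" if "0 < x" for x
    using operator_monotone_le_tangent[OF assms(11,15) that] assms(12) by (simp add: P_beta_def field_simps)
  have part3: "C_bound G (quantum_fisher P rho \<theta>0) \<le> C_bound G (quantum_fisher (P_beta \<bar>\<beta>\<bar>) rho \<theta>0)"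
  proof -
    \<comment> \<open>Weights stand in denominators: smaller weights on the same vectors give a
      larger Fisher matrix.\<close>
    have diff: "psd (gram d K e w - quantum_fisher (P_beta \<bar>\<beta>\<bar>) rho \<theta>0)"
      if w: "\<And>k. k \<in> K \<Longrightarrow> 0 < w k \<and> w k \<le> wt (P_beta \<bar>\<beta>\<bar>) k" for w
      unfolding JQ by (rule psd_gram_diff, rule sum_mono) (use w in \<open>auto intro!: divide_left_mono mult_pos_pos wtb\<close>)
    have pb: "psd (quantum_fisher (P_beta \<bar>\<beta>\<bar>) rho \<theta>0)"
      unfolding JQ by (rule psd_gram) (use wtb in \<open>auto simp: less_imp_le\<close>)
    show ?thesis
    proof (cases "0 \<le> \<beta>")
      case True
      have "0 < wt P k \<and> wt P k \<le> wt (P_beta \<bar>\<beta>\<bar>) k" if "k \<in> K" for k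
        using that True assms(10) lam tangent by (auto simp: wt_def K_def)
      from diff[OF this] have "psd (quantum_fisher P rho \<theta>0 - quantum_fisher (P_beta \<bar>\<beta>\<bar>) rho \<theta>0)"
        by (simp add: JQ)
      then have "psd (minv (quantum_fisher (P_beta \<bar>\<beta>\<bar>) rho \<theta>0) - minv (quantum_fisher P rho \<theta>0))"
        using psd_inverse_diff[OF Jbc _ Jbc pb _ invP(1,2) invb(1,2)] by (simp add: JQ hermitian_gram)
      then show ?thesis unfolding C_bound_eq_C_value by (rule C_value_mono[OF G invP(1) hP invb(1) hb])
    next
      case False
      \<comment> \<open>The tangent has slope parameter \<open>\<beta> < 0\<close>; conjugating the Fisher matrix exchanges left and right
        multiplication by the state, which turns \<open>\<beta>\<close> into \<open>- \<beta>\<close> and does not change the bound.\<close>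
      define w where "w = (\<lambda>(a,b). wt P (b,a))"
      have J': "map_mat cnj (quantum_fisher P rho \<theta>0) = gram d K e w"
      proof (rule eq_matI)
        fix i j assume "i < dim_row (gram d K e w)" "j < dim_col (gram d K e w)"
        then have ij: "i < d" "j < d" by auto
        have "map_mat cnj (quantum_fisher P rho \<theta>0) $$ (i,j) = (\<Sum>a<n. \<Sum>b<n. cnj (cnj (E i $$ (a,b)) * E j $$ (a,b) / complex_of_real (wt P (a,b))))"
          using ij unfolding JQ gram_def K_def by (simp add: sum.cartesian_product e_def case_prod_unfold)
        \<comment> \<open>Hermitian \<open>E\<close> turns conjugation of the entries into exchange
          of \<open>a\<close> and \<open>b\<close>; relabelling the sum moves the exchange to the
          weight.\<close>
        also have "\<dots> = (\<Sum>a<n. \<Sum>b<n. cnj (E i $$ (b,a)) * E j $$ (b,a) / complex_of_real (w (b,a)))"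
        proof (intro sum.cong refl)
          fix a b assume "a \<in> {..<n}" "b \<in> {..<n}"
          then have "E i $$ (a,b) = cnj (E i $$ (b,a))" "cnj (E j $$ (a,b)) = E j $$ (b,a)"
            using Eherm[of a b i] Eherm[of b a j] by auto
          then show "cnj (cnj (E i $$ (a,b)) * E j $$ (a,b) / complex_of_real (wt P (a,b))) =
              cnj (E i $$ (b,a)) * E j $$ (b,a) / complex_of_real (w (b,a))" by (simp add: w_def)
        qed
        also have "\<dots> = (\<Sum>a<n. \<Sum>b<n. cnj (E i $$ (a,b)) * E j $$ (a,b) / complex_of_real (w (a,b)))"
          by (rule sum.swap)
        also have "\<dots> = gram d K e w $$ (i,j)"
          using ij unfolding gram_def K_def by (simp add: sum.cartesian_product e_def case_prod_unfold)
        finally show "map_mat cnj (quantum_fisher P rho \<theta>0) $$ (i,j) = gram d K e w $$ (i,j)" .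
      qed (simp_all add: JQ)
      have "0 < w k \<and> w k \<le> wt (P_beta \<bar>\<beta>\<bar>) k" if kK: "k \<in> K" for k
      proof -
        obtain a b where k: "k = (a,b)" "a < n" "b < n" using kK by (auto simp: K_def)
        note l = lam[OF k(2)] lam[OF k(3)]
        have "w k \<le> lam a * P_beta \<beta> (lam b / lam a)"
          using tangent[of "lam b / lam a"] l by (simp add: w_def wt_def k(1))
        \<comment> \<open>Both sides equal
          \<open>(1 + \<beta>) / 2 * lam b + (1 - \<beta>) / 2 * lam a\<close>, as the absolute
          value of \<open>\<beta>\<close> is \<open>- \<beta>\<close> here.\<close>
        also have "\<dots> = lam b * P_beta \<bar>\<beta>\<bar> (lam a / lam b)"
          using False l by (simp add: P_beta_def field_simps)
        finally show ?thesis using l assms(10) by (simp add: w_def wt_def k(1))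
      qed
      from diff[OF this] have dif: "psd (map_mat cnj (quantum_fisher P rho \<theta>0) - quantum_fisher (P_beta \<bar>\<beta>\<bar>) rho \<theta>0)"
        by (simp add: J')
      let ?J = "map_mat cnj (quantum_fisher P rho \<theta>0)" and ?I = "map_mat cnj (minv (quantum_fisher P rho \<theta>0))"
      have Jc: "?J \<in> carrier_mat d d" and Jh: "hermitian ?J" unfolding J' by (simp_all add: hermitian_gram)
      have Ic: "?I \<in> carrier_mat d d" using invP(1) by simp
      have JI: "?J * ?I = 1\<^sub>m d"
        unfolding map_cnj_mult[OF Jbc invP(1), symmetric] invP(2) by (rule eq_matI) auto
      have "psd (minv (quantum_fisher (P_beta \<bar>\<beta>\<bar>) rho \<theta>0) - ?I)"
        by (rule psd_inverse_diff[OF Jc Jh Jbc pb dif Ic JI invb(1,2)])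
      then have "C_value G ?I \<le> C_value G (minv (quantum_fisher (P_beta \<bar>\<beta>\<bar>) rho \<theta>0))"
        by (rule C_value_mono[OF G Ic hermitian_inverse[OF Jc Jh Ic JI] invb(1) hb])
      then show ?thesis unfolding C_bound_eq_C_value C_value_map_cnj[OF G invP(1)] .
    qed
  qed
  from part1 part2 part3 show ?thesis by blast
qed

end
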